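(* Let $G$ be a connected $(c,d)$-biregular simple graph with $c,d\ge2$ and $(c,d)\ne(2,2)$, which is not $K_{2,3}$, $K_{2,4}$, $K_{2,5}$, or $K_{3,3}$. Then \[ 1-\frac{c+d}{cd}\le\frac{\mathscr{K}_{nb}(G)}{\mathscr{K}_e(G)}<1. \]
   Context: A $(c,d)$-biregular graph is a bipartite graph in which every vertex in one part of the bipartition has degree $c$ and every vertex in the other part has degree $d$. Kemeny's constant of an irreducible finite Markov chain with transition matrix $P$ whose eigenvalues (with multiplicity) are $1=\rho_1,\rho_2,\dots,\rho_N$ (with $1$ simple) is $\mathscr{K}(P)=\sum_{i=2}^{N}\frac{1}{1-\rho_i}$. Arcs of $G$: for each edge $\{u,v\}$ the two ordered pairs $(u,v),(v,u)$. $\mathscr{K}_e(G)$ is Kemeny's constant of the chain on arcs where from $(u,v)$ one moves to $(v,w)$ with probability $1/\deg(v)$ for each neighbor $w$ of $v$. $\mathscr{K}_{nb}(G)$ is Kemeny's constant of the non-backtracking chain on arcs where from $(u,v)$ one moves to $(v,w)$ with probability $1/(\deg(v)-1)$ for each neighbor $w\neq u$ of $v$. *)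

theory Defs
  imports Complex_Main "Jordan_Normal_Form.Char_Poly"
begin

definition simple_graph :: "'a set \<Rightarrow> ('a \<Rightarrow> 'a \<Rightarrow> bool) \<Rightarrow> bool" where
  "simple_graph V E \<longleftrightarrow> finite V \<and> (\<forall>u v. E u v \<longrightarrow> u \<in> V \<and> v \<in> V)
     \<and> (\<forall>u v. E u v \<longrightarrow> E v u) \<and> (\<forall>u. \<not> E u u)"

definition neighbors :: "'a set \<Rightarrow> ('a \<Rightarrow> 'a \<Rightarrow> bool) \<Rightarrow> 'a \<Rightarrow> 'a set" where
  "neighbors V E v = {w \<in> V. E v w}"

definition degree :: "'a set \<Rightarrow> ('a \<Rightarrow> 'a \<Rightarrow> bool) \<Rightarrow> 'a \<Rightarrow> nat" where
  "degree V E v = card (neighbors V E v)"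

definition connected_graph :: "'a set \<Rightarrow> ('a \<Rightarrow> 'a \<Rightarrow> bool) \<Rightarrow> bool" where
  "connected_graph V E \<longleftrightarrow> V \<noteq> {} \<and> (\<forall>u\<in>V. \<forall>v\<in>V. E\<^sup>*\<^sup>* u v)"

definition biregular :: "'a set \<Rightarrow> ('a \<Rightarrow> 'a \<Rightarrow> bool) \<Rightarrow> nat \<Rightarrow> nat \<Rightarrow> bool" where
  "biregular V E c d \<longleftrightarrow> (\<exists>X Y. X \<inter> Y = {} \<and> X \<union> Y = V
     \<and> (\<forall>u v. E u v \<longrightarrow> (u \<in> X \<and> v \<in> Y) \<or> (u \<in> Y \<and> v \<in> X))
     \<and> (\<forall>x\<in>X. degree V E x = c) \<and> (\<forall>y\<in>Y. degree V E y = d))"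

definition is_complete_bipartite :: "'a set \<Rightarrow> ('a \<Rightarrow> 'a \<Rightarrow> bool) \<Rightarrow> nat \<Rightarrow> nat \<Rightarrow> bool" where
  "is_complete_bipartite V E m n \<longleftrightarrow> (\<exists>X Y. X \<inter> Y = {} \<and> X \<union> Y = V
     \<and> card X = m \<and> card Y = n
     \<and> (\<forall>u v. E u v \<longleftrightarrow> (u \<in> X \<and> v \<in> Y) \<or> (u \<in> Y \<and> v \<in> X)))"

definition arcs :: "'a set \<Rightarrow> ('a \<Rightarrow> 'a \<Rightarrow> bool) \<Rightarrow> ('a \<times> 'a) set" where
  "arcs V E = {(u, v). u \<in> V \<and> v \<in> V \<and> E u v}"

definition edge_walk :: "'a set \<Rightarrow> ('a \<Rightarrow> 'a \<Rightarrow> bool) \<Rightarrow> 'a \<times> 'a \<Rightarrow> 'a \<times> 'a \<Rightarrow> real" where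
  "edge_walk V E a b = (if snd a = fst b \<and> b \<in> arcs V E then 1 / real (degree V E (snd a)) else 0)"

definition nb_walk :: "'a set \<Rightarrow> ('a \<Rightarrow> 'a \<Rightarrow> bool) \<Rightarrow> 'a \<times> 'a \<Rightarrow> 'a \<times> 'a \<Rightarrow> real" where
  "nb_walk V E a b = (if snd a = fst b \<and> b \<in> arcs V E \<and> snd b \<noteq> fst a
      then 1 / (real (degree V E (snd a)) - 1) else 0)"

text \<open>Matrix (complex entries) of a chain on a finite state set S, w.r.t. an arbitrary fixed
  enumeration of S (the spectrum does not depend on the enumeration).\<close>
definition enum_states :: "'s set \<Rightarrow> 's list" where
  "enum_states S = (SOME xs. distinct xs \<and> set xs = S)"

definition chain_mat :: "'s set \<Rightarrow> ('s \<Rightarrow> 's \<Rightarrow> real) \<Rightarrow> complex mat" where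
  "chain_mat S P = (let xs = enum_states S in
     mat (length xs) (length xs) (\<lambda>(i, j). complex_of_real (P (xs ! i) (xs ! j))))"

text \<open>Kemeny's constant: sum of 1/(1-\<rho>) over the eigenvalues \<rho> (with algebraic multiplicity,
  i.e. multiplicity as roots of the characteristic polynomial) other than the simple eigenvalue 1.
  The sum is real (non-real eigenvalues come in conjugate pairs); we take its real part.\<close>
definition kemeny :: "complex mat \<Rightarrow> real" where
  "kemeny M = Re (\<Sum>\<rho>\<in>{\<rho>. poly (char_poly M) \<rho> = 0} - {1}.
      of_nat (order \<rho> (char_poly M)) / (1 - \<rho>))"

definition kemeny_edge :: "'a set \<Rightarrow> ('a \<Rightarrow> 'a \<Rightarrow> bool) \<Rightarrow> real" where
  "kemeny_edge V E = kemeny (chain_mat (arcs V E) (edge_walk V E))"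

definition kemeny_nb :: "'a set \<Rightarrow> ('a \<Rightarrow> 'a \<Rightarrow> bool) \<Rightarrow> real" where
  "kemeny_nb V E = kemeny (chain_mat (arcs V E) (nb_walk V E))"

end

theory Submission
  imports Defs "Jordan_Normal_Form.Schur_Decomposition"
begin

text \<open>
  Both arc chains alternate between the arcs \<open>X \<rightarrow> Y\<close> and \<open>Y \<rightarrow> X\<close>, so their characteristic
  polynomials are determinants of two-step kernels on the \<open>X \<rightarrow> Y\<close> arcs. Sylvester's identity
  and Schur complements express these through the matrix \<open>W\<close> counting common neighbours of
  vertices of \<open>Y\<close>. Let \<open>c d = s\<^sub>1 > s\<^sub>2 \<ge> \<dots> \<ge> s\<^sub>n\<close> be its eigenvalues, \<open>a = c - 1\<close>, \<open>b = d - 1\<close>,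
  \<open>m = |X|\<close>, \<open>n = |Y|\<close>, \<open>e\<close> the number of edges and \<open>S = \<Sum>\<^sub>i\<^sub>\<ge>\<^sub>2 1 / (c d - s\<^sub>i)\<close>. The edge walk has Kemeny
  constant \<open>2 e - 2 n + 1/2 + 2 c d S\<close>, and the non-backtracking walk has
  \<open>1/2 + (e - m - n + 1) 2 a b / (a b - 1) + (m - n) 2 b / d + 2 (n - 1) + 2 (a b - 1) S\<close>.
  In the lower bound \<open>S\<close> cancels. For the upper bound take \<open>c \<le> d\<close>: the trace of \<open>W\<close> is \<open>n d\<close>, so
  convexity of \<open>1 / t\<close> gives \<open>S \<ge> (n - 1)\<^sup>2 / (n d (c - 1))\<close>, which suffices except for the
  excluded complete bipartite graphs.
\<close>

section \<open>Determinants of matrices indexed by finite sets\<close>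

definition kdelta :: "'s \<Rightarrow> 's \<Rightarrow> complex" where
  "kdelta i j = (if i = j then 1 else 0)"

definition fmat :: "'s list \<Rightarrow> 't list \<Rightarrow> ('s \<Rightarrow> 't \<Rightarrow> complex) \<Rightarrow> complex mat" where
  "fmat xs ys f = mat (length xs) (length ys) (\<lambda>(i, j). f (xs ! i) (ys ! j))"

text \<open>The ordering chosen by \<open>enum_states\<close> is arbitrary; by
  \<open>det_fmat\<close> every ordering of \<open>S\<close> gives the same value.\<close>

definition fdet :: "'s set \<Rightarrow> ('s \<Rightarrow> 's \<Rightarrow> complex) \<Rightarrow> complex" where
  "fdet S f = det (fmat (enum_states S) (enum_states S) f)"

lemma fmat_carrier [simp]: "fmat xs ys f \<in> carrier_mat (length xs) (length ys)"
  by (simp add: fmat_def)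

lemma fmat_dim [simp]: "dim_row (fmat xs ys f) = length xs" "dim_col (fmat xs ys f) = length ys"
  by (simp_all add: fmat_def)

lemma fmat_index [simp]:
  "i < length xs \<Longrightarrow> j < length ys \<Longrightarrow> fmat xs ys f $$ (i, j) = f (xs ! i) (ys ! j)"
  by (simp add: fmat_def)

lemma fmat_cong:
  "(\<And>x y. x \<in> set xs \<Longrightarrow> y \<in> set ys \<Longrightarrow> f x y = g x y) \<Longrightarrow> fmat xs ys f = fmat xs ys g"
  by (auto intro!: eq_matI)

lemma sum_set_nth: "distinct ys \<Longrightarrow> (\<Sum>i = 0..<length ys. h (ys ! i)) = (\<Sum>y\<in>set ys. h y)"
  by (simp add: sum.distinct_set_conv_list sum_list_sum_nth)

lemma fmat_mult:
  assumes "distinct ys"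
  shows "fmat xs ys f * fmat ys zs g = fmat xs zs (\<lambda>x z. \<Sum>y\<in>set ys. f x y * g y z)"
  by (rule eq_matI) (auto simp: scalar_prod_def sum_set_nth[OF assms, symmetric])

lemma fmat_one: "distinct xs \<Longrightarrow> 1\<^sub>m (length xs) = fmat xs xs kdelta"
  by (rule eq_matI) (auto simp: kdelta_def nth_eq_iff_index_eq)

lemma sum_kdelta_left [simp]:
  "finite S \<Longrightarrow> (\<Sum>y\<in>S. kdelta x y * f y) = (if x \<in> S then f x else 0)"
  by (simp add: kdelta_def if_distrib[of "\<lambda>z. z * _"] cong: if_cong)

lemma sum_kdelta_right [simp]:
  "finite S \<Longrightarrow> (\<Sum>y\<in>S. f y * kdelta y x) = (if x \<in> S then f x else 0)"
  by (simp add: kdelta_def if_distrib[of "\<lambda>z. _ * z"] cong: if_cong)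

lemma enum_states:
  assumes "finite S" shows "distinct (enum_states S)" "set (enum_states S) = S"
    "length (enum_states S) = card S"
proof -
  have "\<exists>xs. distinct xs \<and> set xs = S"
    using finite_distinct_list[OF assms] by blast
  then have *: "distinct (enum_states S) \<and> set (enum_states S) = S"
    unfolding enum_states_def by (rule someI_ex)
  then show "distinct (enum_states S)" "set (enum_states S) = S" by auto
  then show "length (enum_states S) = card S" using distinct_card by fastforce
qed

text \<open>Reordering multiplies by \<open>fmat xs ?ys kdelta\<close> on the left and
  \<open>fmat ?ys xs kdelta\<close> on the right. These permutation matrices are inverse to each
  other, so their determinants cancel.\<close>

lemma det_fmat:
  assumes "distinct xs"
  shows "det (fmat xs xs f) = fdet (set xs) f"
proof -
  let ?ys = "enum_states (set xs)"
  have ys: "distinct ?ys" "set ?ys = set xs" "length ?ys = length xs"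
    using enum_states[of "set xs"] assms by (auto simp: distinct_card)
  have eq: "fmat xs xs f = fmat xs ?ys kdelta * fmat ?ys ?ys f * fmat ?ys xs kdelta"
    using ys by (auto simp: fmat_mult intro!: fmat_cong)
  have one: "fmat xs ?ys kdelta * fmat ?ys xs kdelta = fmat xs xs kdelta"
    using ys by (auto simp: fmat_mult intro!: fmat_cong)
  have c: "fmat xs ?ys g \<in> carrier_mat (length xs) (length xs)"
    "fmat ?ys xs g \<in> carrier_mat (length xs) (length xs)"
    "fmat ?ys ?ys g \<in> carrier_mat (length xs) (length xs)" for g
    using ys(3) by auto
  have "det (fmat xs ?ys kdelta) * det (fmat ?ys xs kdelta) = 1"
    unfolding det_mult[OF c(1) c(2), symmetric] one fmat_one[OF assms, symmetric] by simp
  then show ?thesis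
    unfolding eq fdet_def det_mult[OF mult_carrier_mat[OF c(1) c(3)] c(2)] det_mult[OF c(1) c(3)]
    by (simp add: algebra_simps)
qed

lemma fdet_cong:
  "finite S \<Longrightarrow> (\<And>x y. x \<in> S \<Longrightarrow> y \<in> S \<Longrightarrow> f x y = g x y) \<Longrightarrow> fdet S f = fdet S g"
  unfolding fdet_def by (auto simp: enum_states intro!: arg_cong[where f = det] fmat_cong)

lemma fdet_mult:
  assumes "finite S"
  shows "fdet S f * fdet S g = fdet S (\<lambda>x z. \<Sum>y\<in>S. f x y * g y z)"
  unfolding fdet_def
  by (simp add: fmat_mult enum_states[OF assms] flip: det_mult[OF fmat_carrier fmat_carrier])

lemma fdet_smult:
  assumes "finite S"
  shows "fdet S (\<lambda>x y. k * f x y) = k ^ card S * fdet S f"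
proof -
  have "fmat xs xs (\<lambda>x y. k * f x y) = k \<cdot>\<^sub>m fmat xs xs f" for xs
    by (rule eq_matI) auto
  then show ?thesis unfolding fdet_def using enum_states[OF assms] by simp
qed

lemma fdet_kdelta: "finite S \<Longrightarrow> fdet S kdelta = 1"
  unfolding fdet_def by (simp add: enum_states flip: fmat_one)

lemma fdet_scalar: "finite S \<Longrightarrow> fdet S (\<lambda>i j. k * kdelta i j) = k ^ card S"
  by (simp add: fdet_smult fdet_kdelta)

section \<open>Block determinants, Schur complements and Sylvester's identity\<close>

lemma fmat_append:
  "fmat (xs @ ys) (xs @ ys) f = four_block_mat (fmat xs xs f) (fmat xs ys f) (fmat ys xs f) (fmat ys ys f)"
  by (rule eq_matI) (auto simp: nth_append)

text \<open>Block triangular in either orientation: \<open>fdet_block\<close> uses the upper one for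
  its multiplier and the lower one for the product.\<close>

lemma fdet_Un_zero:
  assumes "finite S" "finite T" "S \<inter> T = {}"
    and "(\<forall>x\<in>S. \<forall>y\<in>T. f x y = 0) \<or> (\<forall>x\<in>T. \<forall>y\<in>S. f x y = 0)"
  shows "fdet (S \<union> T) f = fdet S f * fdet T f"
proof -
  let ?xs = "enum_states S" and ?ys = "enum_states T"
  note e = enum_states[OF assms(1)] enum_states[OF assms(2)]
  have "fdet (S \<union> T) f = det (fmat (?xs @ ?ys) (?xs @ ?ys) f)"
    using e assms(3) by (subst det_fmat) auto
  also have "\<dots> = fdet S f * fdet T f"
    unfolding fmat_append fdet_def
  proof (cases "\<forall>x\<in>S. \<forall>y\<in>T. f x y = 0")
    case True
    then have "fmat ?xs ?ys f = 0\<^sub>m (length ?xs) (length ?ys)"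
      using e by (intro eq_matI) (auto, metis nth_mem)
    then show "det (four_block_mat (fmat ?xs ?xs f) (fmat ?xs ?ys f) (fmat ?ys ?xs f) (fmat ?ys ?ys f)) =
      det (fmat ?xs ?xs f) * det (fmat ?ys ?ys f)"
      by (intro det_four_block_mat_upper_right_zero[OF fmat_carrier _ fmat_carrier fmat_carrier])
  next
    case False
    then have "\<forall>x\<in>T. \<forall>y\<in>S. f x y = 0" using assms(4) by blast
    then have "fmat ?ys ?xs f = 0\<^sub>m (length ?ys) (length ?xs)"
      using e by (intro eq_matI) (auto, metis nth_mem)
    then show "det (four_block_mat (fmat ?xs ?xs f) (fmat ?xs ?ys f) (fmat ?ys ?xs f) (fmat ?ys ?ys f)) =
      det (fmat ?xs ?xs f) * det (fmat ?ys ?ys f)"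
      by (intro det_four_block_mat_lower_left_zero[OF fmat_carrier fmat_carrier _ fmat_carrier])
  qed
  finally show ?thesis .
qed

text \<open>Schur complement of a scalar block. Right multiplication by \<open>g\<close>, with
  blocks 1, \<open>- f\<close>, 0 and \<open>k\<close>, clears the block from \<open>S\<close> to
  \<open>T\<close> without dividing by \<open>k\<close>. The identity thus covers
  \<open>k = 0\<close>, and later every value of the polynomial variable.\<close>

lemma fdet_block:
  assumes S: "finite S" and T: "finite T" and disj: "S \<inter> T = {}"
    and f: "\<And>i j. i \<in> S \<Longrightarrow> j \<in> S \<Longrightarrow> f i j = k * kdelta i j"
  shows "k ^ card T * fdet (S \<union> T) f
       = k ^ card S * fdet T (\<lambda>i j. k * f i j - (\<Sum>l\<in>S. f i l * f l j))"
proof -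
  define g where "g i j = (if i \<in> S then if j \<in> S then kdelta i j else - f i j
    else if j \<in> S then 0 else k * kdelta i j)" for i j
  define h where "h i j = (\<Sum>l\<in>S \<union> T. f i l * g l j)" for i j
  have h_split: "h i j = (\<Sum>l\<in>S. f i l * g l j) + (\<Sum>l\<in>T. f i l * g l j)" for i j
    unfolding h_def using S T disj by (rule sum.union_disjoint)
  have hS: "h i j = f i j" if "j \<in> S" for i j
  proof -
    have "(\<Sum>l\<in>S. f i l * g l j) = (\<Sum>l\<in>S. f i l * kdelta l j)"
      using that by (intro sum.cong) (auto simp: g_def)
    moreover have "(\<Sum>l\<in>T. f i l * g l j) = 0"
      using that disj by (intro sum.neutral) (auto simp: g_def)
    ultimately show ?thesis using that S by (simp add: h_split)
  qed
  have hT: "h i j = k * f i j - (\<Sum>l\<in>S. f i l * f l j)" if "j \<in> T" for i j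
  proof -
    have "j \<notin> S" using that disj by auto
    then have "(\<Sum>l\<in>S. f i l * g l j) = (\<Sum>l\<in>S. - (f i l * f l j))"
      by (intro sum.cong) (auto simp: g_def)
    moreover have "(\<Sum>l\<in>T. f i l * g l j) = (\<Sum>l\<in>T. (k * f i l) * kdelta l j)"
      using disj \<open>j \<notin> S\<close> by (intro sum.cong) (auto simp: g_def)
    ultimately show ?thesis using that T by (simp add: h_split sum_negf)
  qed
  have hST: "h i j = 0" if "i \<in> S" "j \<in> T" for i j
  proof -
    have "(\<Sum>l\<in>S. f i l * f l j) = (\<Sum>l\<in>S. kdelta i l * (k * f l j))"
      using that f by (intro sum.cong) (auto simp: kdelta_def)
    then show ?thesis using that S by (simp add: hT)
  qed
  have "fdet (S \<union> T) g = fdet S g * fdet T g"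
    using S T disj by (intro fdet_Un_zero) (auto simp: g_def)
  also have "fdet S g = fdet S kdelta"
    using S by (intro fdet_cong) (auto simp: g_def)
  also have "fdet T g = fdet T (\<lambda>i j. k * kdelta i j)"
    using T disj by (intro fdet_cong) (auto simp: g_def)
  finally have g: "fdet (S \<union> T) g = k ^ card T"
    using S T by (simp add: fdet_kdelta fdet_scalar)
  have "fdet (S \<union> T) h = fdet S h * fdet T h"
    using S T disj hST by (intro fdet_Un_zero) auto
  also have "fdet S h = fdet S (\<lambda>i j. k * kdelta i j)"
    using S f by (intro fdet_cong) (auto simp: hS)
  also have "fdet T h = fdet T (\<lambda>i j. k * f i j - (\<Sum>l\<in>S. f i l * f l j))"
    using T by (intro fdet_cong) (auto simp: hT)
  finally show ?thesis
    using fdet_mult[of "S \<union> T" f g] g S T by (simp add: h_def[abs_def] fdet_scalar mult.commute)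
qed

lemma fdet_image:
  assumes "finite S" "inj_on h S"
  shows "fdet (h ` S) f = fdet S (\<lambda>i j. f (h i) (h j))"
proof -
  let ?xs = "enum_states S"
  note e = enum_states[OF assms(1)]
  have "fdet (h ` S) f = det (fmat (map h ?xs) (map h ?xs) f)"
    using e assms by (subst det_fmat) (auto simp: distinct_map)
  also have "fmat (map h ?xs) (map h ?xs) f = fmat ?xs ?xs (\<lambda>i j. f (h i) (h j))"
    by (rule eq_matI) auto
  finally show ?thesis unfolding fdet_def .
qed

text \<open>Both sides equal \<open>k ^ card T\<close> times the determinant of the block matrix
  \<open>M\<close> with rows (k, f) and (g, 1): eliminating \<open>T\<close> through its identity
  block gives the left side, eliminating \<open>S\<close> through its block \<open>k\<close> the
  right. The sum type makes the two index sets disjoint.\<close>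

lemma fdet_sylvester:
  assumes S: "finite S" and T: "finite T"
  shows "k ^ card T * fdet S (\<lambda>i j. k * kdelta i j - (\<Sum>l\<in>T. f i l * g l j))
       = k ^ card S * fdet T (\<lambda>i j. k * kdelta i j - (\<Sum>l\<in>S. g i l * f l j))"
proof -
  let ?S = "Inl ` S :: ('a + 'b) set" and ?T = "Inr ` T :: ('a + 'b) set"
  define M where "M p q = (case p of
      Inl i \<Rightarrow> (case q of Inl j \<Rightarrow> k * kdelta i j | Inr j \<Rightarrow> f i j)
    | Inr i \<Rightarrow> (case q of Inl j \<Rightarrow> g i j | Inr j \<Rightarrow> kdelta i j))" for p q :: "'a + 'b"
  have "fdet (?T \<union> ?S) M = fdet ?S (\<lambda>i j. M i j - (\<Sum>l\<in>?T. M i l * M l j))"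
  proof -
    have "M i j = 1 * kdelta i j" if "i \<in> ?T" "j \<in> ?T" for i j
      using that by (auto simp: M_def kdelta_def split: if_splits)
    from fdet_block[of ?T ?S M 1, OF _ _ _ this] show ?thesis using S T by auto
  qed
  also have "\<dots> = fdet S (\<lambda>i j. k * kdelta i j - (\<Sum>l\<in>T. f i l * g l j))"
    using S by (subst fdet_image) (auto simp: M_def sum.reindex)
  finally have 1: "fdet (?T \<union> ?S) M = \<dots>" .
  have "k ^ card ?T * fdet (?S \<union> ?T) M
      = k ^ card ?S * fdet ?T (\<lambda>i j. k * M i j - (\<Sum>l\<in>?S. M i l * M l j))"
    using S T by (intro fdet_block) (auto simp: M_def kdelta_def split: if_splits)
  also have "fdet ?T (\<lambda>i j. k * M i j - (\<Sum>l\<in>?S. M i l * M l j))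
      = fdet T (\<lambda>i j. k * kdelta i j - (\<Sum>l\<in>S. g i l * f l j))"
    using T by (subst fdet_image) (auto simp: M_def sum.reindex)
  finally show ?thesis using 1 by (simp add: Un_commute card_image)
qed

section \<open>Characteristic polynomials, eigenvalues and the trace\<close>

lemma poly_char_poly_fmat:
  assumes "finite S"
  shows "poly (char_poly (fmat (enum_states S) (enum_states S) f)) x
       = fdet S (\<lambda>i j. x * kdelta i j - f i j)"
  unfolding char_poly_def fdet_def
  by (rule poly_det_cong[of _ "length (enum_states S)"])
    (use enum_states(1)[OF assms] in \<open>auto simp: char_poly_matrix_def kdelta_def nth_eq_iff_index_eq\<close>)

text \<open>The trace is cyclic (\<open>tr\<close>), hence invariant under conjugation.\<close>

lemma trace_similar:
  fixes A :: "complex mat"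
  assumes "similar_mat_wit A B P Q" and A: "A \<in> carrier_mat n n"
  shows "(\<Sum>i<n. A $$ (i, i)) = (\<Sum>i<n. B $$ (i, i))"
proof -
  note w = similar_mat_witD2[OF A assms(1)]
  have tr: "(\<Sum>i<n. (M * N) $$ (i, i)) = (\<Sum>i<n. (N * M) $$ (i, i))"
    if "M \<in> carrier_mat n n" "N \<in> carrier_mat n n" for M N :: "complex mat"
  proof -
    have "(\<Sum>i<n. (M * N) $$ (i, i)) = (\<Sum>i<n. \<Sum>j = 0..<n. M $$ (i, j) * N $$ (j, i))"
      using that by (intro sum.cong) (auto simp: scalar_prod_def)
    also have "\<dots> = (\<Sum>j<n. \<Sum>i = 0..<n. N $$ (j, i) * M $$ (i, j))"
      by (subst sum.swap) (auto simp: mult.commute lessThan_atLeast0)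
    also have "\<dots> = (\<Sum>i<n. (N * M) $$ (i, i))"
      using that by (intro sum.cong) (auto simp: scalar_prod_def)
    finally show ?thesis .
  qed
  have "(\<Sum>i<n. A $$ (i, i)) = (\<Sum>i<n. (P * B * Q) $$ (i, i))" using w by simp
  also have "\<dots> = (\<Sum>i<n. (Q * (P * B)) $$ (i, i))" using w by (intro tr) auto
  also have "Q * (P * B) = (Q * P) * B" using w by (intro assoc_mult_mat[symmetric]) auto
  also have "\<dots> = B" using w by simp
  finally show ?thesis .
qed

text \<open>\<open>es\<close> lists the roots of the characteristic polynomial over the complex
  numbers. Two parameters \<open>u\<close> and \<open>v\<close> are kept because for the
  non-backtracking walk both depend on the polynomial variable.\<close>

lemma fdet_eigenvalues:
  fixes f :: "'s \<Rightarrow> 's \<Rightarrow> complex"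
  assumes S: "finite S"
  obtains es where "length es = card S"
    "\<And>u v. fdet S (\<lambda>i j. u * kdelta i j - v * f i j) = (\<Prod>e\<leftarrow>es. u - v * e)"
    "sum_list es = (\<Sum>i\<in>S. f i i)"
    "\<And>e. e \<in> set es \<Longrightarrow> \<exists>w. (\<exists>i\<in>S. w i \<noteq> 0) \<and> (\<forall>i\<in>S. (\<Sum>j\<in>S. f i j * w j) = e * w i)"
proof -
  define xs where "xs = enum_states S"
  have xs: "distinct xs" "set xs = S" "length xs = card S"
    using enum_states[OF S] by (auto simp: xs_def)
  define A where "A = fmat xs xs f"
  have A: "A \<in> carrier_mat (length xs) (length xs)" by (simp add: A_def)
  obtain es where cp: "char_poly A = (\<Prod>a\<leftarrow>es. [:- a, 1:])" and len: "length es = length xs"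
    using char_poly_factorized[OF A] by blast
  have poly: "fdet S (\<lambda>i j. x * kdelta i j - f i j) = (\<Prod>e\<leftarrow>es. x - e)" for x
    unfolding poly_char_poly_fmat[OF S, symmetric] xs_def[symmetric] A_def[symmetric] cp
    by (simp add: poly_prod_list o_def)
  have det: "fdet S (\<lambda>i j. u * kdelta i j - v * f i j) = (\<Prod>e\<leftarrow>es. u - v * e)" for u v
  proof (cases "v = 0")
    case True
    then show ?thesis using S len xs by (simp add: fdet_scalar map_replicate_const)
  next
    case False
    have "fdet S (\<lambda>i j. u * kdelta i j - v * f i j)
        = fdet S (\<lambda>i j. v * ((u / v) * kdelta i j - f i j))"
      using S False by (intro fdet_cong) (auto simp: field_simps)
    also have "\<dots> = v ^ length es * (\<Prod>e\<leftarrow>es. u / v - e)"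
      by (simp only: fdet_smult[OF S] poly len xs(3))
    also have "\<dots> = (\<Prod>e\<leftarrow>es. u - v * e)"
      using False by (induction es) (auto simp: field_simps)
    finally show ?thesis .
  qed
  \<comment> \<open>Schur's upper triangular form has \<open>es\<close> on its diagonal, which turns
    the trace into \<open>sum_list es\<close>.\<close>
  obtain B P Q where "schur_decomposition A es = (B, P, Q)"
    by (cases "schur_decomposition A es") auto
  from schur_decomposition[OF A cp this]
  have sim: "similar_mat_wit A B P Q" and diag: "diag_mat B = es" by auto
  have "(\<Sum>i\<in>S. f i i) = (\<Sum>i<length xs. A $$ (i, i))"
    using sum_set_nth[OF xs(1), of "\<lambda>i. f i i"] xs by (simp add: A_def lessThan_atLeast0)
  also have "\<dots> = (\<Sum>i<length xs. B $$ (i, i))" by (rule trace_similar[OF sim A])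
  also have "\<dots> = sum_list es"
    using similar_mat_witD2[OF A sim] unfolding diag[symmetric] diag_mat_def
    by (auto simp: interv_sum_list_conv_sum_set_nat lessThan_atLeast0)
  finally have trace: "sum_list es = (\<Sum>i\<in>S. f i i)" ..
  have ev: "\<exists>w. (\<exists>i\<in>S. w i \<noteq> 0) \<and> (\<forall>i\<in>S. (\<Sum>j\<in>S. f i j * w j) = e * w i)" if "e \<in> set es" for e
  proof -
    have "eigenvalue A e"
      unfolding eigenvalue_root_char_poly[OF A] cp using that
      by (auto simp: poly_prod_list prod_list_zero_iff)
    then obtain v where v: "dim_vec v = length xs" "v \<noteq> 0\<^sub>v (length xs)" "A *\<^sub>v v = e \<cdot>\<^sub>v v"
      using A unfolding eigenvalue_def eigenvector_def by (auto dest: carrier_vecD)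
    \<comment> \<open>Vectors are indexed by positions; since \<open>xs\<close> is distinct,
      \<open>w\<close> can read off the entry at the position of \<open>s\<close>.\<close>
    define w where "w s = v $ (THE i. i < length xs \<and> xs ! i = s)" for s
    have w: "w (xs ! i) = v $ i" if "i < length xs" for i
      unfolding w_def using that xs(1) by (intro arg_cong[where f = "vec_index v"] the_equality)
        (auto simp: nth_eq_iff_index_eq)
    obtain i where "i < length xs" "v $ i \<noteq> 0" using v by fastforce
    then have "\<exists>i\<in>S. w i \<noteq> 0" using w xs(2) by (metis nth_mem)
    moreover have "(\<Sum>j\<in>S. f i j * w j) = e * w i" if "i \<in> S" for i
    proof -
      obtain k where k: "k < length xs" "i = xs ! k" using \<open>i \<in> S\<close> xs(2) by (metis in_set_conv_nth)
      have "(\<Sum>j\<in>S. f i j * w j) = (\<Sum>j = 0..<length xs. f i (xs ! j) * w (xs ! j))"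
        using sum_set_nth[OF xs(1), of "\<lambda>j. f i j * w j"] xs by simp
      also have "\<dots> = (A *\<^sub>v v) $ k" using k v(1) by (auto simp: scalar_prod_def A_def w)
      also have "\<dots> = e * w i" using v k w by simp
      finally show ?thesis .
    qed
    ultimately show ?thesis by blast
  qed
  show thesis using that[OF _ det trace ev] len xs by simp
qed

section \<open>Root sums of polynomials\<close>

text \<open>The sum in \<open>kemeny\<close> before the real part is taken, as a function of the
  polynomial alone, so that factorisations become additions.\<close>

definition ksum :: "complex poly \<Rightarrow> complex" where
  "ksum p = (\<Sum>\<rho>\<in>{\<rho>. poly p \<rho> = 0} - {1}. of_nat (Polynomial.order \<rho> p) / (1 - \<rho>))"

lemma kemeny_ksum: "kemeny M = Re (ksum (char_poly M))"
  by (simp add: kemeny_def ksum_def)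

text \<open>Non-roots have order 0 and add nothing. A common index set for \<open>p\<close>,
  \<open>q\<close> and \<open>p * q\<close> makes \<open>ksum_mult\<close> a termwise
  identity.\<close>

lemma ksum_superset:
  assumes "p \<noteq> 0" "finite R" "{\<rho>. poly p \<rho> = 0} \<subseteq> R"
  shows "ksum p = (\<Sum>\<rho>\<in>R - {1}. of_nat (Polynomial.order \<rho> p) / (1 - \<rho>))"
  unfolding ksum_def using assms
  by (intro sum.mono_neutral_left) (auto simp: order_root)

lemma ksum_mult:
  assumes "p \<noteq> 0" "q \<noteq> 0"
  shows "ksum (p * q) = ksum p + ksum q"
proof -
  let ?R = "{\<rho>. poly p \<rho> = 0} \<union> {\<rho>. poly q \<rho> = 0}"
  have R: "finite ?R" using assms by (simp add: poly_roots_finite)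
  have "ksum r = (\<Sum>\<rho>\<in>?R - {1}. of_nat (Polynomial.order \<rho> r) / (1 - \<rho>))" if "r \<in> {p, q, p * q}" for r
    using that assms R by (intro ksum_superset) auto
  then show ?thesis
    using assms by (simp add: order_mult add_divide_distrib sum.distrib)
qed

lemma ksum_power: "p \<noteq> 0 \<Longrightarrow> ksum (p ^ n) = of_nat n * ksum p"
proof (induction n)
  case 0
  show ?case by (simp add: ksum_def)
next
  case (Suc n)
  then show ?case by (simp add: ksum_mult algebra_simps)
qed

lemma ksum_prod_list: "0 \<notin> set ps \<Longrightarrow> ksum (prod_list ps) = (\<Sum>p\<leftarrow>ps. ksum p)"
proof (induction ps)
  case Nil
  show ?case by (simp add: ksum_def)
next
  case (Cons p ps)
  then show ?case by (simp add: ksum_mult prod_list_zero_iff)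
qed

lemma ksum_const: "k \<noteq> 0 \<Longrightarrow> ksum [:k:] = 0"
  by (simp add: ksum_def)

lemma ksum_linear: "ksum [:- r, 1:] = (if r = 1 then 0 else 1 / (1 - r))"
proof -
  have "{\<rho>. poly [:- r, 1:] \<rho> = 0} = {r}" by auto
  moreover have "Polynomial.order r [:- r, 1:] = 1"
    using order_power_n_n[of r 1] by simp
  ultimately show ?thesis by (auto simp: ksum_def)
qed

lemma ksum_X [simp]: "ksum [:0, 1:] = 1"
  using ksum_linear[of 0] by simp

text \<open>The roots are \<open>r\<close> and \<open>- r\<close>, and 1 / (1 - r) + 1 / (1 + r) = 2
  / (1 - r^2). If \<open>\<alpha> + \<beta> = 0\<close> they are 1 and -1; the root 1 is left out
  and -1 contributes 1/2. Even factors arise because both walks alternate between two classes of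
  arcs.\<close>

lemma ksum_even_quadratic:
  assumes "\<alpha> \<noteq> 0"
  shows "ksum [:\<beta>, 0, \<alpha>:] = (if \<alpha> + \<beta> = 0 then 1 / 2 else 2 * \<alpha> / (\<alpha> + \<beta>))"
proof -
  define r where "r = csqrt (- \<beta> / \<alpha>)"
  have r2: "r * r = - \<beta> / \<alpha>" unfolding r_def by (metis power2_csqrt power2_eq_square)
  then have \<beta>: "\<beta> = - \<alpha> * r * r" using assms by (simp add: field_simps)
  have fac: "[:\<beta>, 0, \<alpha>:] = [:\<alpha>:] * ([:- r, 1:] * [:- (- r), 1:])"
    by (simp add: \<beta>)
  have k: "ksum [:\<beta>, 0, \<alpha>:] = ksum [:- r, 1:] + ksum [:- (- r), 1:]"
  proof -
    have nz: "[:\<alpha>:] \<noteq> 0" "[:- r, 1:] \<noteq> 0" "[:- (- r), 1:] \<noteq> 0" using assms by auto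
    show ?thesis
      unfolding fac ksum_mult[OF nz(1) no_zero_divisors[OF nz(2,3)]] ksum_mult[OF nz(2,3)]
        ksum_const[OF assms] by simp
  qed
  have sum: "\<alpha> + \<beta> = \<alpha> * ((1 - r) * (1 + r))" by (simp add: \<beta> algebra_simps)
  show ?thesis
  proof (cases "r = 1 \<or> r = - 1")
    case True
    then show ?thesis unfolding k ksum_linear sum by auto
  next
    case False
    then have "1 - r \<noteq> 0" "1 + r \<noteq> 0" by (auto simp: eq_neg_iff_add_eq_0 add.commute)
    then have "1 / (1 - r) + 1 / (1 + r) = 2 / ((1 - r) * (1 + r))"
      by (simp add: add_frac_eq)
    also have "\<dots> = 2 * \<alpha> / (\<alpha> * ((1 - r) * (1 + r)))"
      using assms by simp
    finally have "1 / (1 - r) + 1 / (1 + r) = 2 * \<alpha> / (\<alpha> * ((1 - r) * (1 + r)))" .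
    then show ?thesis unfolding k ksum_linear sum
      using False assms \<open>1 - r \<noteq> 0\<close> \<open>1 + r \<noteq> 0\<close> by (auto simp: minus_equation_iff[of r])
  qed
qed

text \<open>As a quadratic in \<open>z\<close> the polynomial has roots \<open>z1\<close> and
  \<open>z2\<close> with sum \<open>s - a - b\<close> and product \<open>k\<close>, so it splits
  into two even quadratics. The hypothesis on \<open>s\<close> says that neither root is
  \<open>k\<close>, that is, that 1 is not a root of the polynomial.\<close>

lemma ksum_biquadratic:
  fixes a b s :: complex
  assumes k: "k = a * b" "k \<noteq> 0" and s: "s \<noteq> (a + 1) * (b + 1)"
  defines "z \<equiv> [:0, 0, k:]"
  shows "ksum ((z + [:a:]) * (z + [:b:]) - [:s:] * z)
       = 2 * (2 * k + a + b - s) / ((a + 1) * (b + 1) - s)"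
    and "(z + [:a:]) * (z + [:b:]) - [:s:] * z \<noteq> 0"
proof -
  define t where "t = s - a - b"
  define z1 where "z1 = (t + csqrt (t\<^sup>2 - 4 * k)) / 2"
  define z2 where "z2 = (t - csqrt (t\<^sup>2 - 4 * k)) / 2"
  have sum: "z1 + z2 = t" by (simp add: z1_def z2_def field_simps)
  have "2 * z1 = t + csqrt (t\<^sup>2 - 4 * k)" "2 * z2 = t - csqrt (t\<^sup>2 - 4 * k)"
    by (simp_all add: z1_def z2_def)
  then have "(2 * z1) * (2 * z2) = t\<^sup>2 - (csqrt (t\<^sup>2 - 4 * k))\<^sup>2"
    by (simp only: square_diff_square_factored power2_eq_square)
  then have prod: "z1 * z2 = k" by simp
  have fac: "(z + [:a:]) * (z + [:b:]) - [:s:] * z = [:- z1, 0, k:] * [:- z2, 0, k:]"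
  proof -
    have "k * b + k * a - s * k = - (k * (z1 + z2))"
      by (simp add: sum t_def algebra_simps)
    then show ?thesis using prod k by (simp add: z_def algebra_simps)
  qed
  have den: "(k - z1) * (k - z2) = k * ((a + 1) * (b + 1) - s)"
  proof -
    have "(k - z1) * (k - z2) = k * k - k * (z1 + z2) + z1 * z2" by (simp add: algebra_simps)
    then show ?thesis unfolding sum prod t_def using k by (simp add: algebra_simps)
  qed
  then have nz: "k - z1 \<noteq> 0" "k - z2 \<noteq> 0" using s k(2) by auto
  have "ksum ([:- z1, 0, k:] * [:- z2, 0, k:]) = 2 * k / (k - z1) + 2 * k / (k - z2)"
    by (subst ksum_mult) (use k(2) nz in \<open>simp_all add: ksum_even_quadratic\<close>)
  also have "\<dots> = 2 * k * (2 * k - (z1 + z2)) / ((k - z1) * (k - z2))"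
    using nz by (simp add: field_simps)
  also have "\<dots> = 2 * (2 * k + a + b - s) / ((a + 1) * (b + 1) - s)"
  proof -
    have "2 * k * (2 * k - (s - a - b)) = k * (2 * (2 * k + a + b - s))"
      by (simp add: algebra_simps)
    then show ?thesis unfolding den sum t_def using k(2) by simp
  qed
  finally show "ksum ((z + [:a:]) * (z + [:b:]) - [:s:] * z)
       = 2 * (2 * k + a + b - s) / ((a + 1) * (b + 1) - s)" unfolding fac .
  show "(z + [:a:]) * (z + [:b:]) - [:s:] * z \<noteq> 0" unfolding fac using k(2) by simp
qed

text \<open>Multiplying \<open>p - q\<close> by the variable removes the exceptional point. This
  recovers at 0 identities that were obtained by cancelling the variable.\<close>

lemma poly_eq_off_zero:
  fixes p q :: "complex poly"
  assumes "\<And>x. x \<noteq> 0 \<Longrightarrow> poly p x = poly q x"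
  shows "p = q"
proof -
  have "poly ([:0, 1:] * (p - q)) x = 0" for x
    using assms[of x] by auto
  then have "[:0, 1:] * (p - q) = 0" using poly_all_0_iff_0 by blast
  then show ?thesis by simp
qed

lemma sum_list_of_real: "(\<Sum>r\<leftarrow>rs. complex_of_real (f r)) = complex_of_real (\<Sum>r\<leftarrow>rs. f r)"
  by (induction rs) auto

section \<open>Biregular graphs\<close>

locale biregular_graph =
  fixes X Y :: "'a set" and E :: "'a \<Rightarrow> 'a \<Rightarrow> bool" and c d :: nat
  assumes finite_X: "finite X" and finite_Y: "finite Y" and disjoint: "X \<inter> Y = {}"
    and E_sym: "E u v \<Longrightarrow> E v u"
    and E_bipartite: "E u v \<Longrightarrow> u \<in> X \<and> v \<in> Y \<or> u \<in> Y \<and> v \<in> X"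
    and degree_X: "x \<in> X \<Longrightarrow> card {y \<in> Y. E x y} = c"
    and degree_Y: "y \<in> Y \<Longrightarrow> card {x \<in> X. E x y} = d"
    and connected: "u \<in> X \<union> Y \<Longrightarrow> v \<in> X \<union> Y \<Longrightarrow> E\<^sup>*\<^sup>* u v"
    and nonempty: "X \<union> Y \<noteq> {}"
    and c_ge: "c \<ge> 2" and d_ge: "d \<ge> 2"
begin

section \<open>The common-neighbour matrix and its spectrum\<close>

definition inc :: "'a \<Rightarrow> 'a \<Rightarrow> complex" where
  "inc x y = (if E x y then 1 else 0)"

definition W :: "'a \<Rightarrow> 'a \<Rightarrow> complex" where
  "W y y' = (\<Sum>x\<in>X. inc x y * inc x y')"

lemma inc_idem [simp]: "inc u v * inc u v = inc u v"
  by (simp add: inc_def)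

lemma sum_inc_Y [simp]: "x \<in> X \<Longrightarrow> (\<Sum>y\<in>Y. inc x y) = of_nat c"
  using degree_X[of x] finite_Y by (simp add: inc_def sum.If_cases Int_def)

lemma sum_inc_X [simp]: "y \<in> Y \<Longrightarrow> (\<Sum>x\<in>X. inc x y) = of_nat d"
  using degree_Y[of y] finite_X by (simp add: inc_def sum.If_cases Int_def)

lemma Y_nonempty: "Y \<noteq> {}" and X_nonempty: "X \<noteq> {}"
proof -
  have "\<exists>y. y \<in> Y" if "x \<in> X" for x
    using degree_X[OF that] c_ge by (cases "Y = {}") auto
  moreover have "\<exists>x. x \<in> X" if "y \<in> Y" for y
    using degree_Y[OF that] d_ge by (cases "X = {}") auto
  ultimately show "Y \<noteq> {}" "X \<noteq> {}" using nonempty by auto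
qed

lemma card_Y_pos: "card Y > 0"
  using Y_nonempty finite_Y by (auto simp: card_gt_0_iff)

lemma c_le_card_Y: "c \<le> card Y"
proof -
  obtain x where "x \<in> X" using X_nonempty by auto
  then show ?thesis using degree_X[of x] card_mono[OF finite_Y, of "{y \<in> Y. E x y}"] by auto
qed

lemma double_count: "card X * c = card Y * d"
proof -
  have "of_nat (card X * c) = (\<Sum>x\<in>X. \<Sum>y\<in>Y. inc x y)" by simp
  also have "\<dots> = (\<Sum>y\<in>Y. \<Sum>x\<in>X. inc x y)" by (rule sum.swap)
  also have "\<dots> = of_nat (card Y * d)" by simp
  finally show ?thesis using of_nat_eq_iff by blast
qed

lemma W_row_sum: "y \<in> Y \<Longrightarrow> (\<Sum>y'\<in>Y. W y y') = of_nat (c * d)"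
proof -
  assume y: "y \<in> Y"
  have "(\<Sum>y'\<in>Y. W y y') = (\<Sum>x\<in>X. \<Sum>y'\<in>Y. inc x y * inc x y')"
    unfolding W_def by (rule sum.swap)
  also have "\<dots> = (\<Sum>x\<in>X. inc x y * of_nat c)"
    by (intro sum.cong) (auto simp: sum_distrib_left[symmetric])
  also have "\<dots> = of_nat d * of_nat c" using y by (simp only: sum_distrib_right[symmetric] sum_inc_X)
  also have "\<dots> = of_nat (c * d)" by simp
  finally show ?thesis .
qed

lemma W_sym: "W y y' = W y' y"
  by (simp add: W_def mult.commute)

lemma W_diag: "y \<in> Y \<Longrightarrow> W y y = of_nat d"
  by (simp add: W_def)

text \<open>With B the biadjacency matrix, \<open>W\<close> is B^T B and \<open>q\<close> is B w.
  Hence \<open>s * N = M\<close> for the squared norms \<open>N\<close> of \<open>w\<close> and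
  \<open>M\<close> of \<open>q\<close>, so \<open>s\<close> is real. The sum of |c w(y) - q(x)|^2
  over the edges equals \<open>c * (c * d * N - M)\<close>, which gives the bound. Equality forces c
  w(y) = q(x) on every edge, and connectedness makes \<open>w\<close> constant.\<close>

lemma W_eigenvalue:
  assumes ev: "\<And>y. y \<in> Y \<Longrightarrow> (\<Sum>y'\<in>Y. W y y' * w y') = s * w y" and nz: "\<exists>y\<in>Y. w y \<noteq> 0"
  obtains r where "s = complex_of_real r" "r \<le> real (c * d)"
    "r = real (c * d) \<Longrightarrow> (\<exists>k. \<forall>y\<in>Y. w y = k)"
proof -
  define q where "q x = (\<Sum>y\<in>Y. inc x y * w y)" for x
  define N where "N = (\<Sum>y\<in>Y. (cmod (w y))\<^sup>2)"
  define M where "M = (\<Sum>x\<in>X. (cmod (q x))\<^sup>2)"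
  have Npos: "N > 0" unfolding N_def using nz finite_Y by (auto intro!: sum_pos2)
  have cnj_inc: "cnj (inc x y) = inc x y" for x y by (simp add: inc_def)
  have cq: "cnj (q x) = (\<Sum>y\<in>Y. inc x y * cnj (w y))" for x by (simp add: q_def cnj_sum cnj_inc)
  have "s * complex_of_real N = (\<Sum>y\<in>Y. cnj (w y) * (\<Sum>y'\<in>Y. W y y' * w y'))"
  proof -
    have "cnj (w y) * (\<Sum>y'\<in>Y. W y y' * w y') = s * complex_of_real ((cmod (w y))\<^sup>2)"
      if "y \<in> Y" for y unfolding ev[OF that] complex_norm_square by (simp add: mult_ac)
    then have "(\<Sum>y\<in>Y. cnj (w y) * (\<Sum>y'\<in>Y. W y y' * w y'))
        = (\<Sum>y\<in>Y. s * complex_of_real ((cmod (w y))\<^sup>2))" by (rule sum.cong[OF refl])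
    then show ?thesis unfolding N_def of_real_sum sum_distrib_left by (rule sym)
  qed
  also have "\<dots> = (\<Sum>y\<in>Y. \<Sum>x\<in>X. cnj (w y) * inc x y * q x)"
  proof (rule sum.cong[OF refl])
    fix y
    have "(\<Sum>y'\<in>Y. W y y' * w y') = (\<Sum>x\<in>X. inc x y * q x)"
      unfolding W_def q_def sum_distrib_left sum_distrib_right
      by (subst sum.swap) (simp add: mult_ac)
    then show "cnj (w y) * (\<Sum>y'\<in>Y. W y y' * w y') = (\<Sum>x\<in>X. cnj (w y) * inc x y * q x)"
      by (simp add: sum_distrib_left mult_ac)
  qed
  also have "\<dots> = (\<Sum>x\<in>X. cnj (q x) * q x)"
    by (subst sum.swap) (simp add: cq sum_distrib_right sum_distrib_left mult_ac)
  also have "\<dots> = complex_of_real M"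
    unfolding M_def of_real_sum complex_norm_square by (simp only: mult.commute)
  finally have sN: "s * complex_of_real N = complex_of_real M" .
  define r where "r = M / N"
  have s: "s = complex_of_real r" using sN Npos by (simp add: r_def field_simps)
  define D where "D x y = (if E x y then (cmod (of_nat c * w y - q x))\<^sup>2 else 0)" for x y
  have D: "complex_of_real (D x y) = inc x y * ((of_nat c * w y - q x) * cnj (of_nat c * w y - q x))"
    for x y unfolding complex_norm_square[symmetric] by (simp add: D_def inc_def)
  have Dx: "(\<Sum>y\<in>Y. complex_of_real (D x y))
      = (of_nat c)\<^sup>2 * (\<Sum>y\<in>Y. inc x y * (w y * cnj (w y))) - of_nat c * (q x * cnj (q x))"
    if "x \<in> X" for x
  proof -
    have "(\<Sum>y\<in>Y. complex_of_real (D x y)) = (\<Sum>y\<in>Y. (of_nat c)\<^sup>2 * (inc x y * (w y * cnj (w y)))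
        - of_nat c * cnj (q x) * (inc x y * w y) - of_nat c * q x * (inc x y * cnj (w y))
        + inc x y * (q x * cnj (q x)))"
      by (intro sum.cong) (auto simp: D algebra_simps power2_eq_square)
    also have "\<dots> = (of_nat c)\<^sup>2 * (\<Sum>y\<in>Y. inc x y * (w y * cnj (w y)))
        - of_nat c * cnj (q x) * q x - of_nat c * q x * cnj (q x) + of_nat c * (q x * cnj (q x))"
      using that by (simp add: sum.distrib sum_subtractf sum_distrib_left[symmetric]
          sum_distrib_right[symmetric] q_def[symmetric] cq[symmetric])
    finally show ?thesis by (simp add: algebra_simps)
  qed
  have "complex_of_real (\<Sum>x\<in>X. \<Sum>y\<in>Y. D x y)
      = (of_nat c)\<^sup>2 * (\<Sum>x\<in>X. \<Sum>y\<in>Y. inc x y * (w y * cnj (w y))) - of_nat c * complex_of_real M"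
    unfolding M_def of_real_sum complex_norm_square sum_distrib_left sum_subtractf[symmetric]
    by (intro sum.cong refl) (simp only: Dx sum_distrib_left)
  also have "(\<Sum>x\<in>X. \<Sum>y\<in>Y. inc x y * (w y * cnj (w y))) = of_nat d * complex_of_real N"
  proof -
    have "(\<Sum>x\<in>X. \<Sum>y\<in>Y. inc x y * (w y * cnj (w y))) = (\<Sum>y\<in>Y. \<Sum>x\<in>X. inc x y * (w y * cnj (w y)))"
      by (rule sum.swap)
    also have "\<dots> = (\<Sum>y\<in>Y. of_nat d * complex_of_real ((cmod (w y))\<^sup>2))"
      by (intro sum.cong refl)
        (simp only: sum_distrib_right[symmetric] sum_inc_X complex_norm_square)
    finally show ?thesis by (simp add: N_def sum_distrib_left)
  qed
  finally have "complex_of_real (\<Sum>x\<in>X. \<Sum>y\<in>Y. D x y)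
      = complex_of_real (real c * (real (c * d) * N - M))"
    by (simp add: algebra_simps power2_eq_square)
  then have sumD: "(\<Sum>x\<in>X. \<Sum>y\<in>Y. D x y) = real c * (real (c * d) * N - M)"
    using of_real_eq_iff by blast
  have D0: "D x y \<ge> 0" for x y by (simp add: D_def)
  have "0 \<le> real c * (real (c * d) * N - M)"
    unfolding sumD[symmetric] by (intro sum_nonneg D0)
  then have "M \<le> real (c * d) * N" using c_ge by (simp add: zero_le_mult_iff)
  then have le: "r \<le> real (c * d)" using Npos by (simp add: r_def divide_le_eq)
  have const: "\<exists>k. \<forall>y\<in>Y. w y = k" if "r = real (c * d)"
  proof -
    have "(\<Sum>x\<in>X. \<Sum>y\<in>Y. D x y) = 0" using that Npos sumD by (simp add: r_def field_simps)
    then have z: "D x y = 0" if "x \<in> X" "y \<in> Y" for x y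
      using that D0 finite_X finite_Y by (simp add: sum_nonneg_eq_0_iff sum_nonneg)
    \<comment> \<open>Gluing c w on \<open>Y\<close> and \<open>q\<close> on \<open>X\<close> gives
      one function that is constant along edges, hence along every walk.\<close>
    define p where "p v = (if v \<in> Y then of_nat c * w v else q v)" for v
    have step: "p u = p v" if "E u v" for u v
    proof -
      have *: "of_nat c * w y = q x" if "E x y" "x \<in> X" "y \<in> Y" for x y
        using z[of x y] that by (simp add: D_def)
      show ?thesis
        using E_bipartite[OF that] *[of u v] *[of v u] that E_sym[OF that] disjoint
        by (auto simp: p_def)
    qed
    have "p u = p v" if "E\<^sup>*\<^sup>* u v" for u v
      using that by induction (auto dest: step)
    then have eq: "p y = p y'" if "y \<in> Y" "y' \<in> Y" for y y' using connected that by blast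
    have "w y = w y'" if "y \<in> Y" "y' \<in> Y" for y y'
      using eq[OF that] that c_ge by (simp add: p_def)
    then show ?thesis using Y_nonempty by blast
  qed
  show thesis using that[OF s le const] .
qed

text \<open>Subtracting the projection onto the constant vectors replaces the Perron eigenvalue \<open>c * d\<close>
  by 0. Every eigenvector for another nonzero eigenvalue then has zero sum, so it is not constant
  and connectedness makes its eigenvalue smaller than \<open>c * d\<close>.\<close>

lemma W_spectrum:
  obtains rs :: "real list" where "length rs = card Y - 1" "\<And>r. r \<in> set rs \<Longrightarrow> r < real (c * d)"
    "sum_list rs = real (card Y * d) - real (c * d)"
    "\<And>u v. fdet Y (\<lambda>i j. u * kdelta i j - v * W i j)
        = (u - v * of_nat (c * d)) * (\<Prod>r\<leftarrow>rs. u - v * complex_of_real r)"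
proof -
  define n where "n = card Y"
  have n: "n > 0" using card_Y_pos by (simp add: n_def)
  \<comment> \<open>With J the all-ones matrix, \<open>t\<close> is chosen so that t J agrees with
    \<open>W\<close> on constant vectors; rows and columns of \<open>W'\<close> then sum to
    0.\<close>
  define t :: complex where "t = of_nat (c * d) / of_nat n"
  define W' where "W' y y' = W y y' - t" for y y'
  have tn: "t * of_nat n = of_nat (c * d)" using n by (simp add: t_def)
  have row: "(\<Sum>y'\<in>Y. W' y y') = 0" if "y \<in> Y" for y
    using W_row_sum[OF that] tn by (simp add: W'_def sum_subtractf n_def[symmetric] mult.commute)
  have col: "(\<Sum>y\<in>Y. W' y y') = 0" if "y' \<in> Y" for y'
    using row[OF that] W_sym by (simp add: W'_def)
  obtain es where es: "length es = n"
    "\<And>u v. fdet Y (\<lambda>i j. u * kdelta i j - v * W' i j) = (\<Prod>e\<leftarrow>es. u - v * e)"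
    "sum_list es = (\<Sum>i\<in>Y. W' i i)"
    "\<And>e. e \<in> set es \<Longrightarrow> \<exists>w. (\<exists>i\<in>Y. w i \<noteq> 0) \<and> (\<forall>i\<in>Y. (\<Sum>j\<in>Y. W' i j * w j) = e * w i)"
    by (rule fdet_eigenvalues[OF finite_Y, of W', folded n_def]) blast
  obtain fs where fs:
    "\<And>u v. fdet Y (\<lambda>i j. u * kdelta i j - v * W i j) = (\<Prod>e\<leftarrow>fs. u - v * e)"
    by (rule fdet_eigenvalues[OF finite_Y, of W]) blast
  \<comment> \<open>The matrix t J has rank one, so Sylvester's identity with a one-point set
    computes the determinant. The extra factor \<open>u\<close> avoids a division.\<close>
  have rank1: "u * fdet Y (\<lambda>i j. u * kdelta i j - v * t) = u ^ n * (u - v * of_nat (c * d))" for u v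
  proof -
    have "fdet {()} f = f () ()" for f :: "unit \<Rightarrow> unit \<Rightarrow> complex"
    proof -
      have "fdet {()} f = fdet {()} (\<lambda>i j. f () () * kdelta i j)"
        by (intro fdet_cong) (auto simp: kdelta_def)
      then show ?thesis using fdet_scalar[of "{()}" "f () ()"] by simp
    qed
    with fdet_sylvester[OF finite_Y, of "{()}" u "\<lambda>i l. v * t" "\<lambda>l j. 1"]
    show ?thesis using tn by (simp add: n_def[symmetric] kdelta_def mult_ac)
  qed
  \<comment> \<open>Since W' J = 0, (u - v W') (u - v t J) = u (u - v W); the relation follows by
    taking determinants.\<close>
  have rel: "u * (\<Prod>e\<leftarrow>fs. u - v * e) = (u - v * of_nat (c * d)) * (\<Prod>e\<leftarrow>es. u - v * e)"
    if "u \<noteq> 0" for u v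
  proof -
    have "fdet Y (\<lambda>i j. u * kdelta i j - v * W' i j) * fdet Y (\<lambda>i j. u * kdelta i j - v * t)
        = fdet Y (\<lambda>i j. u * (u * kdelta i j - v * W i j))"
      unfolding fdet_mult[OF finite_Y]
    proof (rule fdet_cong[OF finite_Y])
      fix i j assume ij: "i \<in> Y" "j \<in> Y"
      have "(\<Sum>y\<in>Y. (u * kdelta i y - v * W' i y) * (u * kdelta y j - v * t))
        = (\<Sum>y\<in>Y. kdelta i y * (u * u * kdelta y j)) - (\<Sum>y\<in>Y. kdelta i y * (u * v * t))
          - (\<Sum>y\<in>Y. u * v * W' i y * kdelta y j) + v * v * t * (\<Sum>y\<in>Y. W' i y)"
        by (simp only: sum_distrib_left sum_subtractf[symmetric] sum.distrib[symmetric])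
          (simp add: algebra_simps)
      also have "\<dots> = u * u * kdelta i j - u * v * t - u * v * W' i j"
        using ij finite_Y by (simp add: row)
      finally show "(\<Sum>y\<in>Y. (u * kdelta i y - v * W' i y) * (u * kdelta y j - v * t))
          = u * (u * kdelta i j - v * W i j)"
        by (simp add: W'_def algebra_simps)
    qed
    also have "\<dots> = u ^ n * (\<Prod>e\<leftarrow>fs. u - v * e)"
      by (simp add: fdet_smult finite_Y fs n_def)
    finally have "(\<Prod>e\<leftarrow>es. u - v * e) * (u ^ n * (u - v * of_nat (c * d))) = u * (u ^ n * (\<Prod>e\<leftarrow>fs. u - v * e))"
      unfolding es(2) rank1[symmetric] by (simp add: mult_ac)
    then show ?thesis using that by (simp add: mult_ac)
  qed
  \<comment> \<open>At 0 the left side below vanishes while the factor - c d on the right does not,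
    so 0 is an eigenvalue of \<open>W'\<close>. It is the one that replaces c d and is removed
    next.\<close>
  have zero: "0 \<in> set es"
  proof -
    have "[:0, 1:] * (\<Prod>e\<leftarrow>fs. [:- e, 1:]) = [:- of_nat (c * d), 1:] * (\<Prod>e\<leftarrow>es. [:- e, 1:])"
      using rel[of _ 1] by (intro poly_eq_off_zero) (simp add: poly_prod_list o_def left_diff_distrib)
    from arg_cong[OF this, of "\<lambda>p. poly p 0"] show ?thesis using c_ge d_ge by (auto simp: poly_prod_list prod_list_zero_iff)
  qed
  define ss where "ss = remove1 0 es"
  have perm: "mset es = mset (0 # ss)" using zero by (simp add: ss_def)
  have es_prod: "(\<Prod>e\<leftarrow>es. u - v * e) = u * (\<Prod>e\<leftarrow>ss. u - v * e)" for u v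
  proof -
    have "prod_mset (image_mset (\<lambda>e. u - v * e) (mset es))
        = prod_mset (image_mset (\<lambda>e. u - v * e) (mset (0 # ss)))" by (simp only: perm)
    then show ?thesis by (simp add: prod_mset_prod_list flip: mset_map)
  qed
  have det: "fdet Y (\<lambda>i j. u * kdelta i j - v * W i j)
      = (u - v * of_nat (c * d)) * (\<Prod>s\<leftarrow>ss. u - v * s)" for u v
  proof -
    have "(\<Prod>e\<leftarrow>fs. u - v * e) = (u - v * of_nat (c * d)) * (\<Prod>e\<leftarrow>ss. u - v * e)"
      if "u \<noteq> 0" for u
      using rel[OF that, of v] that by (simp add: es_prod)
    \<comment> \<open>The relation is known only for nonzero \<open>u\<close>; reading both sides as
      polynomials in \<open>u\<close> extends it to 0.\<close>
    then have "(\<Prod>e\<leftarrow>fs. [:- (v * e), 1:]) = [:- (v * of_nat (c * d)), 1:] * (\<Prod>e\<leftarrow>ss. [:- (v * e), 1:])"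
      by (intro poly_eq_off_zero) (simp add: poly_prod_list o_def left_diff_distrib)
    from arg_cong[OF this, of "\<lambda>p. poly p u"] show ?thesis
      by (simp add: fs poly_prod_list o_def left_diff_distrib)
  qed
  have real: "\<exists>r. s = complex_of_real r \<and> r < real (c * d)" if "s \<in> set es" for s
  proof (cases "s = 0")
    case True
    then show ?thesis using c_ge d_ge by (intro exI[of _ 0]) auto
  next
    case False
    from es(4)[OF that] obtain w where w: "\<exists>i\<in>Y. w i \<noteq> 0"
      "\<And>i. i \<in> Y \<Longrightarrow> (\<Sum>j\<in>Y. W' i j * w j) = s * w i" by auto
    have "s * (\<Sum>i\<in>Y. w i) = (\<Sum>i\<in>Y. \<Sum>j\<in>Y. W' i j * w j)"
      by (simp add: w(2) sum_distrib_left)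
    also have "\<dots> = (\<Sum>j\<in>Y. (\<Sum>i\<in>Y. W' i j) * w j)"
      by (subst sum.swap) (simp add: sum_distrib_right)
    also have "\<dots> = 0" by (simp add: col)
    finally have sum0: "(\<Sum>i\<in>Y. w i) = 0" using False by simp
    \<comment> \<open>As \<open>w\<close> has zero sum, t J annihilates it, so \<open>w\<close> is
      an eigenvector of \<open>W\<close> itself for the same eigenvalue.\<close>
    have "(\<Sum>j\<in>Y. W i j * w j) = s * w i" if "i \<in> Y" for i
      using w(2)[OF that] sum0
      by (simp add: W'_def left_diff_distrib sum_subtractf sum_distrib_left[symmetric])
    from W_eigenvalue[OF this w(1)] obtain r where r: "s = complex_of_real r" "r \<le> real (c * d)"
      "r = real (c * d) \<Longrightarrow> (\<exists>k. \<forall>y\<in>Y. w y = k)" by blast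
    have "r \<noteq> real (c * d)"
    proof
      assume "r = real (c * d)"
      then obtain k where k: "\<And>y. y \<in> Y \<Longrightarrow> w y = k" using r(3) by blast
      then have "of_nat n * k = 0" using sum0 by (simp add: n_def)
      then show False using w(1) k n by auto
    qed
    then show ?thesis using r by auto
  qed
  have ss_es: "set ss \<subseteq> set es" unfolding ss_def by (rule set_remove1_subset)
  define rs where "rs = map Re ss"
  have ss: "ss = map complex_of_real rs"
    unfolding rs_def map_map using real ss_es by (intro map_idI[symmetric]) fastforce
  show thesis
  proof (rule that[of rs])
    show "length rs = card Y - 1" using es(1) zero by (simp add: rs_def ss_def length_remove1 n_def)
    show "r < real (c * d)" if "r \<in> set rs" for r
      using that real ss_es unfolding rs_def by fastforce
    have "sum_list es = sum_list ss"
    proof -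
      have "sum_mset (mset es) = sum_mset (mset (0 # ss))" by (simp only: perm)
      then show ?thesis by (simp add: sum_mset_sum_list)
    qed
    also have "\<dots> = complex_of_real (sum_list rs)"
      unfolding ss by (induction rs) auto
    finally have "complex_of_real (sum_list rs) = (\<Sum>i\<in>Y. W' i i)" using es(3) by simp
    also have "\<dots> = complex_of_real (real (card Y * d) - real (c * d))"
      using tn by (simp add: W'_def W_diag n_def[symmetric] right_diff_distrib mult.commute)
    finally show "sum_list rs = real (card Y * d) - real (c * d)" using of_real_eq_iff by blast
    show "fdet Y (\<lambda>i j. u * kdelta i j - v * W i j)
        = (u - v * of_nat (c * d)) * (\<Prod>r\<leftarrow>rs. u - v * complex_of_real r)" for u v
      unfolding det by (simp add: ss o_def)
  qed
qed

section \<open>Arcs and the two-step kernels of the two walks\<close>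

definition F :: "('a \<times> 'a) set" where
  "F = {(x, y). x \<in> X \<and> y \<in> Y \<and> E x y}"

definition F' :: "('a \<times> 'a) set" where
  "F' = {(y, x). y \<in> Y \<and> x \<in> X \<and> E x y}"

lemma finite_F: "finite F" and finite_F': "finite F'"
  by (rule finite_subset[of _ "X \<times> Y"], use finite_X finite_Y in \<open>auto simp: F_def\<close>)
    (rule finite_subset[of _ "Y \<times> X"], use finite_X finite_Y in \<open>auto simp: F'_def\<close>)

lemma F_disjoint: "F' \<inter> F = {}"
  using disjoint by (auto simp: F_def F'_def)

lemma arcs_F: "arcs (X \<union> Y) E = F' \<union> F"
  using E_bipartite E_sym by (fastforce simp: arcs_def F_def F'_def)

lemma sum_F: "(\<Sum>e\<in>F. g (fst e) (snd e)) = (\<Sum>x\<in>X. \<Sum>y\<in>Y. inc x y * g x y)"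
proof -
  have "(\<Sum>x\<in>X. \<Sum>y\<in>Y. inc x y * g x y) = (\<Sum>(x, y)\<in>X \<times> Y. inc x y * g x y)"
    by (rule sum.cartesian_product)
  also have "\<dots> = (\<Sum>(x, y)\<in>F. inc x y * g x y)"
    using finite_X finite_Y by (intro sum.mono_neutral_right) (auto simp: F_def inc_def split: if_splits)
  also have "\<dots> = (\<Sum>e\<in>F. g (fst e) (snd e))"
    by (intro sum.cong) (auto simp: F_def inc_def)
  finally show ?thesis ..
qed

lemma card_F: "card F = card Y * d"
proof -
  have "complex_of_nat (card F) = (\<Sum>x\<in>X. \<Sum>y\<in>Y. inc x y)"
    using sum_F[of "\<lambda>x y. 1"] by simp
  also have "\<dots> = of_nat (card Y * d)" by (simp add: double_count flip: of_nat_mult)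
  finally show ?thesis using of_nat_eq_iff by blast
qed

lemma degree_eq: "x \<in> X \<Longrightarrow> Defs.degree (X \<union> Y) E x = c" "y \<in> Y \<Longrightarrow> Defs.degree (X \<union> Y) E y = d"
proof -
  assume "x \<in> X"
  moreover from this have "neighbors (X \<union> Y) E x = {y \<in> Y. E x y}"
    using E_bipartite[of x] disjoint by (auto simp: neighbors_def)
  ultimately show "Defs.degree (X \<union> Y) E x = c" using degree_X by (simp add: degree_def)
next
  assume "y \<in> Y"
  moreover from this have "neighbors (X \<union> Y) E y = {x \<in> X. E x y}"
    using E_bipartite[of y] E_sym disjoint by (auto simp: neighbors_def)
  ultimately show "Defs.degree (X \<union> Y) E y = d" using degree_Y by (simp add: degree_def)
qed

text \<open>No step stays within \<open>F\<close> or within \<open>F'\<close>, so both diagonal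
  blocks of the characteristic matrix are \<open>x\<close> times the identity and
  \<open>fdet_block\<close> eliminates \<open>F'\<close>. The power of \<open>x\<close> stays on
  both sides so that \<open>x = 0\<close> is covered.\<close>

lemma chain_poly:
  assumes "\<And>i j. i \<in> F \<Longrightarrow> j \<in> F \<Longrightarrow> P i j = 0" "\<And>i j. i \<in> F' \<Longrightarrow> j \<in> F' \<Longrightarrow> P i j = 0"
    and two: "\<And>i j. i \<in> F \<Longrightarrow> j \<in> F \<Longrightarrow> (\<Sum>l\<in>F'. complex_of_real (P i l) * complex_of_real (P l j)) = Q i j"
  shows "x ^ card F * poly (char_poly (chain_mat (arcs (X \<union> Y) E) P)) x
       = x ^ card F * fdet F (\<lambda>i j. x\<^sup>2 * kdelta i j - Q i j)"
proof -
  have cF: "card F' = card F"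
  proof -
    have "F' = prod.swap ` F" by (auto simp: F_def F'_def image_iff)
    then show ?thesis by (simp add: card_image)
  qed
  have "chain_mat (arcs (X \<union> Y) E) P = fmat (enum_states (F' \<union> F)) (enum_states (F' \<union> F))
    (\<lambda>i j. complex_of_real (P i j))"
    by (simp add: chain_mat_def fmat_def arcs_F Let_def)
  then have "x ^ card F * poly (char_poly (chain_mat (arcs (X \<union> Y) E) P)) x
      = x ^ card F * fdet (F' \<union> F) (\<lambda>i j. x * kdelta i j - complex_of_real (P i j))"
    using poly_char_poly_fmat[of "F' \<union> F"] finite_F finite_F' by simp
  also have "\<dots> = x ^ card F' * fdet F (\<lambda>i j. x * (x * kdelta i j - complex_of_real (P i j))
      - (\<Sum>l\<in>F'. (x * kdelta i l - complex_of_real (P i l)) * (x * kdelta l j - complex_of_real (P l j))))"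
    using assms(2) by (intro fdet_block finite_F finite_F' F_disjoint) auto
  also have "\<dots> = x ^ card F * fdet F (\<lambda>i j. x\<^sup>2 * kdelta i j - Q i j)"
    unfolding cF
  proof (intro arg_cong2[of _ _ _ _ "(*)"] refl fdet_cong[OF finite_F])
    fix i j assume ij: "i \<in> F" "j \<in> F"
    have "(\<Sum>l\<in>F'. (x * kdelta i l - complex_of_real (P i l)) * (x * kdelta l j - complex_of_real (P l j)))
       = (\<Sum>l\<in>F'. complex_of_real (P i l) * complex_of_real (P l j))"
      using ij F_disjoint by (intro sum.cong) (auto simp: kdelta_def)
    then show "x * (x * kdelta i j - complex_of_real (P i j))
      - (\<Sum>l\<in>F'. (x * kdelta i l - complex_of_real (P i l)) * (x * kdelta l j - complex_of_real (P l j)))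
      = x\<^sup>2 * kdelta i j - Q i j"
      using ij assms by (simp add: power2_eq_square)
  qed
  finally show ?thesis .
qed

text \<open>Two steps from (x, y) to (x', y') pass through the single arc (y, x'), which exists iff
  x' is adjacent to y; the probability is 1/d times 1/c.\<close>

lemma edge_chain_poly:
  "x ^ card F * poly (char_poly (chain_mat (arcs (X \<union> Y) E) (edge_walk (X \<union> Y) E))) x
   = x ^ card F * fdet F (\<lambda>i j. x\<^sup>2 * kdelta i j - inc (fst j) (snd i) / of_nat (c * d))"
proof (rule chain_poly)
  show "edge_walk (X \<union> Y) E i j = 0" if "i \<in> F" "j \<in> F" for i j
    using that disjoint by (auto simp: edge_walk_def F_def)
  show "edge_walk (X \<union> Y) E i j = 0" if "i \<in> F'" "j \<in> F'" for i j
    using that disjoint by (auto simp: edge_walk_def F'_def)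
  fix i j assume ij: "i \<in> F" "j \<in> F"
  have "(\<Sum>l\<in>F'. complex_of_real (edge_walk (X \<union> Y) E i l) * complex_of_real (edge_walk (X \<union> Y) E l j))
      = (\<Sum>l\<in>F'. if l = (snd i, fst j) then 1 / of_nat (c * d) else 0)"
    using ij by (intro sum.cong) (auto simp: edge_walk_def arcs_F F_def F'_def degree_eq)
  also have "\<dots> = inc (fst j) (snd i) / of_nat (c * d)"
    using ij finite_F' by (auto simp: inc_def F_def F'_def)
  finally show "(\<Sum>l\<in>F'. complex_of_real (edge_walk (X \<union> Y) E i l) * complex_of_real (edge_walk (X \<union> Y) E l j))
      = inc (fst j) (snd i) / of_nat (c * d)" .
qed

text \<open>The two-step non-backtracking kernel on the arcs from \<open>X\<close> to \<open>Y\<close>, without its constant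
  factor, in inclusion-exclusion form.\<close>

definition H :: "'a \<times> 'a \<Rightarrow> 'a \<times> 'a \<Rightarrow> complex" where
  "H i j = inc (fst j) (snd i) - kdelta (fst i) (fst j) - kdelta (snd i) (snd j) + kdelta i j"

lemma nb_chain_poly:
  "x ^ card F * poly (char_poly (chain_mat (arcs (X \<union> Y) E) (nb_walk (X \<union> Y) E))) x
   = x ^ card F * fdet F (\<lambda>i j. x\<^sup>2 * kdelta i j - H i j / ((of_nat c - 1) * (of_nat d - 1)))"
proof (rule chain_poly)
  show "nb_walk (X \<union> Y) E i j = 0" if "i \<in> F" "j \<in> F" for i j
    using that disjoint by (auto simp: nb_walk_def F_def)
  show "nb_walk (X \<union> Y) E i j = 0" if "i \<in> F'" "j \<in> F'" for i j
    using that disjoint by (auto simp: nb_walk_def F'_def)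
  fix i j assume ij: "i \<in> F" "j \<in> F"
  have "(\<Sum>l\<in>F'. complex_of_real (nb_walk (X \<union> Y) E i l) * complex_of_real (nb_walk (X \<union> Y) E l j))
      = (\<Sum>l\<in>F'. if l = (snd i, fst j) then
          (if fst i \<noteq> fst j \<and> snd i \<noteq> snd j then 1 / ((of_nat c - 1) * (of_nat d - 1)) else 0) else 0)"
    using ij by (intro sum.cong) (auto simp: nb_walk_def arcs_F F_def F'_def degree_eq)
  \<comment> \<open>If \<open>i\<close> and \<open>j\<close> share an endpoint, the pair
    \<open>(fst j, snd i)\<close> is \<open>i\<close> or \<open>j\<close> itself, so the
    \<open>inc\<close> term is 1 and the four terms of \<open>H\<close> cancel. Otherwise only the
    \<open>inc\<close> term remains.\<close>
  also have "\<dots> = H i j / ((of_nat c - 1) * (of_nat d - 1))"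
    using ij finite_F' by (auto simp: inc_def F_def F'_def H_def kdelta_def)
  finally show "(\<Sum>l\<in>F'. complex_of_real (nb_walk (X \<union> Y) E i l) * complex_of_real (nb_walk (X \<union> Y) E l j))
      = H i j / ((of_nat c - 1) * (of_nat d - 1))" .
qed

section \<open>Reduction of the determinants from arcs to the vertices of \<open>Y\<close>\<close>

text \<open>The kernel factors through \<open>Y\<close>: \<open>?f\<close> selects the endpoint of
  \<open>i\<close> and \<open>?g\<close> the vertices adjacent to the origin of \<open>j\<close>.
  The product in the opposite order is \<open>W\<close> divided by c d, so Sylvester's identity
  applies.\<close>

lemma edge_det:
  "u ^ card Y * fdet F (\<lambda>i j. u * kdelta i j - inc (fst j) (snd i) / of_nat (c * d))
   = u ^ card F * fdet Y (\<lambda>i j. u * kdelta i j - 1 / of_nat (c * d) * W i j)"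
proof -
  let ?f = "\<lambda>i l. kdelta (snd i) l" and ?g = "\<lambda>l j. inc (fst j) l / of_nat (c * d)"
  have "fdet F (\<lambda>i j. u * kdelta i j - inc (fst j) (snd i) / of_nat (c * d))
      = fdet F (\<lambda>i j. u * kdelta i j - (\<Sum>l\<in>Y. ?f i l * ?g l j))"
    using finite_Y by (intro fdet_cong[OF finite_F]) (auto simp: F_def simp del: times_divide_eq_right)
  moreover have "fdet Y (\<lambda>i j. u * kdelta i j - 1 / of_nat (c * d) * W i j)
      = fdet Y (\<lambda>i j. u * kdelta i j - (\<Sum>l\<in>F. ?g i l * ?f l j))"
  proof (intro fdet_cong[OF finite_Y])
    fix i j assume ij: "i \<in> Y" "j \<in> Y"
    have "(\<Sum>l\<in>F. ?g i l * ?f l j) = (\<Sum>x\<in>X. \<Sum>y\<in>Y. inc x y * (inc x i / of_nat (c * d) * kdelta y j))"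
      by (rule sum_F)
    also have "\<dots> = (\<Sum>x\<in>X. \<Sum>y\<in>Y. (inc x y * inc x i / of_nat (c * d)) * kdelta y j)"
      by (simp add: mult_ac)
    also have "\<dots> = (\<Sum>x\<in>X. inc x j * inc x i / of_nat (c * d))"
      by (simp only: sum_kdelta_right[OF finite_Y] ij if_True)
    also have "\<dots> = 1 / of_nat (c * d) * W i j"
      by (simp add: W_def sum_divide_distrib mult.commute)
    finally show "u * kdelta i j - 1 / of_nat (c * d) * W i j
        = u * kdelta i j - (\<Sum>l\<in>F. ?g i l * ?f l j)" by simp
  qed
  ultimately show ?thesis using fdet_sylvester[OF finite_F finite_Y, of u ?f ?g] by simp
qed

lemma sum_F_fst: "x \<in> X \<Longrightarrow> (\<Sum>l\<in>F. h (fst l) (snd l) * kdelta (fst l) x) = (\<Sum>y\<in>Y. inc x y * h x y)"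
proof -
  assume x: "x \<in> X"
  have "(\<Sum>l\<in>F. h (fst l) (snd l) * kdelta (fst l) x)
      = (\<Sum>x'\<in>X. \<Sum>y\<in>Y. inc x' y * (h x' y * kdelta x' x))"
    by (rule sum_F)
  also have "\<dots> = (\<Sum>x'\<in>X. (\<Sum>y\<in>Y. inc x' y * h x' y) * kdelta x' x)"
    by (simp add: sum_distrib_right sum_distrib_left mult_ac)
  also have "\<dots> = (\<Sum>y\<in>Y. inc x y * h x y)" using x finite_X by simp
  finally show ?thesis .
qed

lemma sum_F_snd: "y \<in> Y \<Longrightarrow> (\<Sum>l\<in>F. h (fst l) (snd l) * kdelta (snd l) y) = (\<Sum>x\<in>X. inc x y * h x y)"
proof -
  assume y: "y \<in> Y"
  have "(\<Sum>l\<in>F. h (fst l) (snd l) * kdelta (snd l) y)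
      = (\<Sum>x\<in>X. \<Sum>y'\<in>Y. inc x y' * (h x y' * kdelta y' y))"
    by (rule sum_F)
  also have "\<dots> = (\<Sum>x\<in>X. \<Sum>y'\<in>Y. (inc x y' * h x y') * kdelta y' y)"
    by (simp add: mult_ac)
  also have "\<dots> = (\<Sum>x\<in>X. inc x y * h x y)" using y finite_Y by simp
  finally show ?thesis .
qed

text \<open>Products of the four terms of \<open>H\<close> with the matrix Q of arcs sharing their
  \<open>X\<close>-endpoint. The third says Q^2 = c Q, as \<open>c\<close> arcs start at each vertex
  of \<open>X\<close>.\<close>

lemma QX_sums:
  assumes "i \<in> F" "j \<in> F"
  shows "(\<Sum>l\<in>F. inc (fst l) (snd i) * kdelta (fst l) (fst j)) = of_nat c * inc (fst j) (snd i)"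
    and "(\<Sum>l\<in>F. kdelta (snd i) (snd l) * kdelta (fst l) (fst j)) = inc (fst j) (snd i)"
    and "(\<Sum>l\<in>F. kdelta (fst i) (fst l) * kdelta (fst l) (fst j)) = of_nat c * kdelta (fst i) (fst j)"
    and "(\<Sum>l\<in>F. kdelta i l * kdelta (fst l) (fst j)) = kdelta (fst i) (fst j)"
proof -
  have j: "fst j \<in> X" and i: "snd i \<in> Y" using assms by (auto simp: F_def)
  show "(\<Sum>l\<in>F. inc (fst l) (snd i) * kdelta (fst l) (fst j)) = of_nat c * inc (fst j) (snd i)"
    using sum_F_fst[OF j, of "\<lambda>x y. inc x (snd i)"] j by (simp flip: sum_distrib_right)
  show "(\<Sum>l\<in>F. kdelta (snd i) (snd l) * kdelta (fst l) (fst j)) = inc (fst j) (snd i)"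
    using sum_F_fst[OF j, of "\<lambda>x y. kdelta (snd i) y"] i finite_Y
    by (simp add: mult.commute[of "inc _ _"])
  show "(\<Sum>l\<in>F. kdelta (fst i) (fst l) * kdelta (fst l) (fst j)) = of_nat c * kdelta (fst i) (fst j)"
    using sum_F_fst[OF j, of "\<lambda>x y. kdelta (fst i) x"] j by (simp flip: sum_distrib_right)
  show "(\<Sum>l\<in>F. kdelta i l * kdelta (fst l) (fst j)) = kdelta (fst i) (fst j)"
    using assms finite_F by simp
qed

text \<open>With \<open>Q\<close> the same-\<open>X\<close>-endpoint matrix, \<open>a - Q\<close> is up to a factor the inverse of \<open>1 - Q\<close>,
  so multiplying by it turns the quadratic kernel \<open>H\<close> into a sum of two low-rank matrices.\<close>

lemma nb_det:
  defines "a \<equiv> complex_of_nat c - 1" and "b \<equiv> complex_of_nat d - 1"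
  obtains \<gamma> where "\<gamma> \<noteq> 0"
    "\<And>z. \<gamma> * fdet F (\<lambda>i j. z * kdelta i j - H i j) * (a * (z - 1)) ^ (card X + card Y) * (- (z + a)) ^ card Y
     = (a * (z - 1)) ^ card F * (- (z + a)) ^ card X
       * fdet Y (\<lambda>i j. - a * ((z + a) * (z + b)) * kdelta i j - (- a * z) * W i j)"
proof -
  have a0: "a \<noteq> 0" using c_ge by (auto simp: a_def)
  have ca: "complex_of_nat c = a + 1" and db: "complex_of_nat d = b + 1" by (auto simp: a_def b_def)
  \<comment> \<open>Since Q^2 = (a + 1) Q, the product (a - Q) (1 - Q) is a times the identity, so
    \<open>G\<close> has nonzero determinant.\<close>
  define G where "G i j = a * kdelta i j - kdelta (fst i) (fst j)" for i j :: "'a \<times> 'a"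
  define \<gamma> where "\<gamma> = fdet F G"
  have "\<gamma> * fdet F (\<lambda>i j. kdelta i j - kdelta (fst i) (fst j)) = fdet F (\<lambda>i j. a * kdelta i j)"
    unfolding \<gamma>_def fdet_mult[OF finite_F]
  proof (intro fdet_cong[OF finite_F])
    fix i j assume ij: "i \<in> F" "j \<in> F"
    have "(\<Sum>l\<in>F. G i l * (kdelta l j - kdelta (fst l) (fst j)))
      = (\<Sum>l\<in>F. G i l * kdelta l j) - a * (\<Sum>l\<in>F. kdelta i l * kdelta (fst l) (fst j))
        + (\<Sum>l\<in>F. kdelta (fst i) (fst l) * kdelta (fst l) (fst j))"
      unfolding sum_distrib_left sum_subtractf[symmetric] sum.distrib[symmetric]
      by (intro sum.cong) (auto simp: G_def algebra_simps)
    also have "(\<Sum>l\<in>F. G i l * kdelta l j) = G i j" using ij finite_F by simp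
    also have "G i j - a * (\<Sum>l\<in>F. kdelta i l * kdelta (fst l) (fst j))
        + (\<Sum>l\<in>F. kdelta (fst i) (fst l) * kdelta (fst l) (fst j)) = a * kdelta i j"
      unfolding QX_sums[OF ij] by (simp add: G_def ca algebra_simps)
    finally show "(\<Sum>l\<in>F. G i l * (kdelta l j - kdelta (fst l) (fst j))) = a * kdelta i j" .
  qed
  then have \<gamma>0: "\<gamma> \<noteq> 0" using a0 by (auto simp: fdet_scalar finite_F)
  have main: "\<gamma> * fdet F (\<lambda>i j. z * kdelta i j - H i j) * (a * (z - 1)) ^ (card X + card Y) * (- (z + a)) ^ card Y
     = (a * (z - 1)) ^ card F * (- (z + a)) ^ card X
       * fdet Y (\<lambda>i j. - a * ((z + a) * (z + b)) * kdelta i j - (- a * z) * W i j)" for z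
  proof -
    let ?k = "a * (z - 1)" and ?k' = "- (z + a)"
    \<comment> \<open>With R the matrix of arcs sharing their \<open>Y\<close>-endpoint, (z - H) (a
      - Q) = a (z - 1) - (z Q - a R). Here \<open>f\<close> and \<open>g\<close> factor z Q - a R
      through the vertex set.\<close>
    define f where "f i l = z * kdelta (fst i) l - a * kdelta (snd i) l" for i :: "'a \<times> 'a" and l
    define g where "g l j = kdelta l (fst j) + kdelta l (snd j)" for l and j :: "'a \<times> 'a"
    have VV: "finite (X \<union> Y)" using finite_X finite_Y by simp
    have "fdet F (\<lambda>i j. z * kdelta i j - H i j) * \<gamma>
        = fdet F (\<lambda>i j. ?k * kdelta i j - (\<Sum>l\<in>X \<union> Y. f i l * g l j))"
      unfolding \<gamma>_def fdet_mult[OF finite_F]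
    proof (intro fdet_cong[OF finite_F])
      fix i j assume ij: "i \<in> F" "j \<in> F"
      have "(\<Sum>l\<in>F. (z * kdelta i l - H i l) * G l j)
        = a * (\<Sum>l\<in>F. (z * kdelta i l - H i l) * kdelta l j)
          - (z - 1) * (\<Sum>l\<in>F. kdelta i l * kdelta (fst l) (fst j))
          + (\<Sum>l\<in>F. inc (fst l) (snd i) * kdelta (fst l) (fst j))
          - (\<Sum>l\<in>F. kdelta (fst i) (fst l) * kdelta (fst l) (fst j))
          - (\<Sum>l\<in>F. kdelta (snd i) (snd l) * kdelta (fst l) (fst j))"
        unfolding sum_distrib_left sum_subtractf[symmetric] sum.distrib[symmetric]
        by (intro sum.cong) (auto simp: G_def H_def algebra_simps)
      also have "(\<Sum>l\<in>F. (z * kdelta i l - H i l) * kdelta l j) = z * kdelta i j - H i j"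
        using ij finite_F by simp
      also have "a * (z * kdelta i j - H i j)
          - (z - 1) * (\<Sum>l\<in>F. kdelta i l * kdelta (fst l) (fst j))
          + (\<Sum>l\<in>F. inc (fst l) (snd i) * kdelta (fst l) (fst j))
          - (\<Sum>l\<in>F. kdelta (fst i) (fst l) * kdelta (fst l) (fst j))
          - (\<Sum>l\<in>F. kdelta (snd i) (snd l) * kdelta (fst l) (fst j))
        = ?k * kdelta i j - (z * kdelta (fst i) (fst j) - a * kdelta (snd i) (snd j))"
        unfolding QX_sums[OF ij] by (simp add: H_def ca algebra_simps)
      also have "z * kdelta (fst i) (fst j) - a * kdelta (snd i) (snd j) = (\<Sum>l\<in>X \<union> Y. f i l * g l j)"
      proof -
        have "(\<Sum>l\<in>X \<union> Y. f i l * g l j)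
          = z * (\<Sum>l\<in>X \<union> Y. kdelta (fst i) l * g l j) - a * (\<Sum>l\<in>X \<union> Y. kdelta (snd i) l * g l j)"
          by (simp add: f_def sum_distrib_left sum_subtractf[symmetric] algebra_simps)
        also have "\<dots> = z * g (fst i) j - a * g (snd i) j"
          using ij VV by (auto simp: F_def)
        also have "\<dots> = z * kdelta (fst i) (fst j) - a * kdelta (snd i) (snd j)"
          using ij disjoint by (auto simp: g_def F_def kdelta_def)
        finally show ?thesis ..
      qed
      finally show "(\<Sum>l\<in>F. (z * kdelta i l - H i l) * G l j) = ?k * kdelta i j - (\<Sum>l\<in>X \<union> Y. f i l * g l j)" .
    qed
    moreover have "?k ^ (card X + card Y) * fdet F (\<lambda>i j. ?k * kdelta i j - (\<Sum>l\<in>X \<union> Y. f i l * g l j))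
      = ?k ^ card F * fdet (X \<union> Y) (\<lambda>i j. ?k * kdelta i j - (\<Sum>l\<in>F. g i l * f l j))"
      using fdet_sylvester[OF finite_F VV, of ?k f g]
      by (simp add: card_Un_disjoint[OF finite_X finite_Y disjoint])
    moreover have "?k' ^ card Y * fdet (X \<union> Y) (\<lambda>i j. ?k * kdelta i j - (\<Sum>l\<in>F. g i l * f l j))
      = ?k' ^ card X * fdet Y (\<lambda>i j. - a * ((z + a) * (z + b)) * kdelta i j - (- a * z) * W i j)"
    proof -
      define m where "m i j = (\<Sum>l\<in>F. g i l * f l j)" for i j
      have mX: "m i j = z * (\<Sum>y\<in>Y. inc j y * (kdelta i j + kdelta i y))" if "j \<in> X" for i j
      proof -
        have "m i j = (\<Sum>l\<in>F. (z * g i l) * kdelta (fst l) j)"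
          unfolding m_def using that disjoint
          by (intro sum.cong) (auto simp: f_def F_def kdelta_def)
        also have "\<dots> = z * (\<Sum>y\<in>Y. inc j y * (kdelta i j + kdelta i y))"
          using sum_F_fst[OF that, of "\<lambda>x y. z * (kdelta i x + kdelta i y)"]
          by (simp add: g_def sum_distrib_left mult_ac)
        finally show ?thesis .
      qed
      have mY: "m i j = - a * (\<Sum>x\<in>X. inc x j * (kdelta i x + kdelta i j))" if "j \<in> Y" for i j
      proof -
        have "m i j = (\<Sum>l\<in>F. (- a * g i l) * kdelta (snd l) j)"
          unfolding m_def using that disjoint
          by (intro sum.cong) (auto simp: f_def F_def kdelta_def)
        also have "\<dots> = - a * (\<Sum>x\<in>X. inc x j * (kdelta i x + kdelta i j))"
          using sum_F_snd[OF that, of "\<lambda>x y. - a * (kdelta i x + kdelta i y)"]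
          by (simp only: g_def sum_distrib_left mult_ac)
        finally show ?thesis .
      qed
      have mXX: "m i j = z * of_nat c * kdelta i j" if "i \<in> X" "j \<in> X" for i j
      proof -
        have "(\<Sum>y\<in>Y. inc j y * (kdelta i j + kdelta i y)) = (\<Sum>y\<in>Y. inc j y) * kdelta i j"
          unfolding sum_distrib_right using that disjoint by (intro sum.cong) (auto simp: kdelta_def)
        then show ?thesis using that by (simp add: mX)
      qed
      have mYX: "m i j = z * inc j i" if "i \<in> Y" "j \<in> X" for i j
      proof -
        have "(\<Sum>y\<in>Y. inc j y * (kdelta i j + kdelta i y)) = (\<Sum>y\<in>Y. kdelta i y * inc j y)"
          using that disjoint by (intro sum.cong) (auto simp: kdelta_def)
        then show ?thesis using that finite_Y by (simp add: mX)
      qed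
      have mXY: "m i j = - a * inc i j" if "i \<in> X" "j \<in> Y" for i j
      proof -
        have "(\<Sum>x\<in>X. inc x j * (kdelta i x + kdelta i j)) = (\<Sum>x\<in>X. kdelta i x * inc x j)"
          using that disjoint by (intro sum.cong) (auto simp: kdelta_def)
        then show ?thesis using that finite_X by (simp add: mY)
      qed
      have mYY: "m i j = - a * of_nat d * kdelta i j" if "i \<in> Y" "j \<in> Y" for i j
      proof -
        have "(\<Sum>x\<in>X. inc x j * (kdelta i x + kdelta i j)) = (\<Sum>x\<in>X. inc x j) * kdelta i j"
          unfolding sum_distrib_right using that disjoint by (intro sum.cong) (auto simp: kdelta_def)
        then show ?thesis using that by (simp add: mY)
      qed
      have XY: "i \<noteq> j" "j \<noteq> i" if "i \<in> X" "j \<in> Y" for i j using that disjoint by auto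
      \<comment> \<open>The block on \<open>X\<close> is scalar: a (z - 1) - z c = - (z + a).
        Eliminating it leaves on \<open>Y\<close> the scalar - (z + a) (a (z - 1) + a d) = - a (z +
        a) (z + b) and the correction a z W.\<close>
      have "?k' ^ card Y * fdet (X \<union> Y) (\<lambda>i j. ?k * kdelta i j - m i j)
        = ?k' ^ card X * fdet Y (\<lambda>i j. ?k' * (?k * kdelta i j - m i j)
            - (\<Sum>l\<in>X. (?k * kdelta i l - m i l) * (?k * kdelta l j - m l j)))"
        by (intro fdet_block finite_X finite_Y disjoint) (simp add: mXX ca algebra_simps)
      also have "fdet Y (\<lambda>i j. ?k' * (?k * kdelta i j - m i j)
            - (\<Sum>l\<in>X. (?k * kdelta i l - m i l) * (?k * kdelta l j - m l j)))
        = fdet Y (\<lambda>i j. - a * ((z + a) * (z + b)) * kdelta i j - (- a * z) * W i j)"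
      proof (intro fdet_cong[OF finite_Y])
        fix i j assume ij: "i \<in> Y" "j \<in> Y"
        have "(\<Sum>l\<in>X. (?k * kdelta i l - m i l) * (?k * kdelta l j - m l j)) = - a * z * W i j"
          unfolding W_def sum_distrib_left using ij XY
          by (intro sum.cong) (auto simp: mYX mXY kdelta_def)
        then show "?k' * (?k * kdelta i j - m i j)
            - (\<Sum>l\<in>X. (?k * kdelta i l - m i l) * (?k * kdelta l j - m l j))
          = - a * ((z + a) * (z + b)) * kdelta i j - (- a * z) * W i j"
          using ij by (simp add: mYY db algebra_simps)
      qed
      finally show ?thesis unfolding m_def .
    qed
    ultimately show ?thesis by (simp add: mult_ac)
  qed
  show thesis using that[OF \<gamma>0 main] .
qed

section \<open>Closed formulas for the two Kemeny constants\<close>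

text \<open>Each factor \<open>x\<close> adds 1 to \<open>ksum\<close>, so comparing exponents in
  \<open>id\<close> gives 3 e - (e + 2 n) = 2 e - 2 n with e = \<open>card F\<close> and n =
  \<open>card Y\<close>. The Perron factor x^2 - 1 gives 1/2 and each eigenvalue in
  \<open>rs\<close> one summand.\<close>

lemma kemeny_edge_formula:
  assumes det: "\<And>u v. fdet Y (\<lambda>i j. u * kdelta i j - v * W i j)
        = (u - v * of_nat (c * d)) * (\<Prod>r\<leftarrow>rs. u - v * complex_of_real r)"
    and lt: "\<And>r. r \<in> set rs \<Longrightarrow> r < real (c * d)"
  shows "kemeny_edge (X \<union> Y) E
    = 2 * real (card F) - 2 * real (card Y) + 1 / 2 + (\<Sum>r\<leftarrow>rs. 2 * real (c * d) / (real (c * d) - r))"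
proof -
  let ?K = "real (c * d)"
  let ?e = "card F" and ?n = "card Y"
  define p where "p = char_poly (chain_mat (arcs (X \<union> Y) E) (edge_walk (X \<union> Y) E))"
  define q where "q = (\<Prod>r\<leftarrow>rs. [:- complex_of_real (r / ?K), 0, 1:])"
  have K: "?K > 0" using c_ge d_ge by simp
  have id: "[:0, 1:] ^ (?e + 2 * ?n) * p = [:0, 1:] ^ (3 * ?e) * ([:- 1, 0, 1:] * q)"
  proof (intro poly_eq_poly_eq_iff[THEN iffD1] ext)
    fix x :: complex
    have q: "poly q x = (\<Prod>r\<leftarrow>rs. x\<^sup>2 - 1 / of_nat (c * d) * complex_of_real r)"
      by (simp add: q_def poly_prod_list o_def power2_eq_square add.commute)
    have "x ^ (?e + 2 * ?n) * poly p x = (x\<^sup>2) ^ ?n * (x ^ ?e * poly p x)"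
      unfolding power_add power_mult[of x 2] by (simp only: mult_ac)
    also have "\<dots> = x ^ ?e * ((x\<^sup>2) ^ ?n * fdet F (\<lambda>i j. x\<^sup>2 * kdelta i j - inc (fst j) (snd i) / of_nat (c * d)))"
      unfolding p_def edge_chain_poly by (simp only: mult_ac)
    also have "\<dots> = x ^ ?e * ((x\<^sup>2) ^ ?e * ((x\<^sup>2 - 1) * poly q x))"
      unfolding edge_det det q using c_ge d_ge by auto
    also have "\<dots> = x ^ (3 * ?e) * ((x\<^sup>2 - 1) * poly q x)"
      by (simp add: power_mult[symmetric] power_add[symmetric])
    finally show "poly ([:0, 1:] ^ (?e + 2 * ?n) * p) x = poly ([:0, 1:] ^ (3 * ?e) * ([:- 1, 0, 1:] * q)) x"
      by (simp add: power2_eq_square algebra_simps)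
  qed
  have q0: "0 \<notin> set (map (\<lambda>r. [:- complex_of_real (r / ?K), 0, 1:]) rs)" by auto
  have qn: "q \<noteq> 0" unfolding q_def using q0 by (simp add: prod_list_zero_iff)
  have "[:0, 1:] ^ (3 * ?e) * ([:- 1, 0, 1:] * q) \<noteq> 0"
    using qn by (intro no_zero_divisors) auto
  then have pn: "p \<noteq> 0" unfolding id[symmetric] by auto
  have "ksum q = (\<Sum>r\<leftarrow>rs. complex_of_real (2 * ?K / (?K - r)))"
  proof -
    have "ksum [:- complex_of_real (r / ?K), 0, 1:] = complex_of_real (2 * ?K / (?K - r))"
      if "r \<in> set rs" for r
    proof -
      have "1 - r / ?K \<noteq> 0" using lt[OF that] K by (simp add: field_simps)
      then have "complex_of_real (1 - r / ?K) \<noteq> 0" by (simp only: of_real_eq_0_iff not_False_eq_True)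
      then have "ksum [:- complex_of_real (r / ?K), 0, 1:] = 2 / complex_of_real (1 - r / ?K)"
        by (subst ksum_even_quadratic) auto
      also have "\<dots> = complex_of_real (2 / (1 - r / ?K))" by simp
      also have "2 / (1 - r / ?K) = 2 * ?K / (?K - r)"
      proof -
        have "2 / (1 - r / k) = 2 * k / (k - r)" if "k > 0" "r < k" for k
          using that by (simp add: field_simps)
        from this[OF K lt[OF that]] show ?thesis .
      qed
      finally show ?thesis .
    qed
    then show ?thesis unfolding q_def ksum_prod_list[OF q0] by (simp add: o_def cong: map_cong)
  qed
  moreover have "ksum ([:0, 1:] ^ (?e + 2 * ?n) * p) = of_nat (?e + 2 * ?n) + ksum p"
    using pn by (subst ksum_mult) (auto simp: ksum_power)
  moreover have "ksum ([:0, 1:] ^ (3 * ?e) * ([:- 1, 0, 1:] * q)) = of_nat (3 * ?e) + (1 / 2 + ksum q)"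
  proof -
    have "ksum ([:- 1, 0, 1:] * q) = 1 / 2 + ksum q"
      using qn by (subst ksum_mult) (auto simp: ksum_even_quadratic)
    moreover have "[:- 1, 0, 1:] * q \<noteq> 0" using qn by (intro no_zero_divisors) auto
    ultimately show ?thesis by (subst ksum_mult) (auto simp: ksum_power)
  qed
  ultimately have "ksum p = complex_of_real (2 * real ?e - 2 * real ?n + 1 / 2
      + (\<Sum>r\<leftarrow>rs. 2 * ?K / (?K - r)))"
    using id by (simp only: sum_list_of_real) (simp add: algebra_simps)
  then show ?thesis unfolding kemeny_edge_def kemeny_ksum p_def[symmetric]
    by (simp only: Re_complex_of_real)
qed

text \<open>Substitute z = a b x^2. Then \<open>f1\<close> is a (z - 1) and \<open>f2\<close> is -
  (z + a), with net exponents e - m - n and m - n. The factor \<open>q1\<close> belongs to the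
  eigenvalue c d: (z + a) (z + b) - c d z = (z - 1) (z - a b), which yields the 1/2 and the extra 1
  in the first coefficient. The hypothesis \<open>a * b > 1\<close> keeps the root z = 1 away from x
  = 1.\<close>

lemma kemeny_nb_formula:
  fixes rs :: "real list"
  defines "a \<equiv> real c - 1" and "b \<equiv> real d - 1"
  assumes det: "\<And>u v. fdet Y (\<lambda>i j. u * kdelta i j - v * W i j)
        = (u - v * of_nat (c * d)) * (\<Prod>r\<leftarrow>rs. u - v * complex_of_real r)"
    and lt: "\<And>r. r \<in> set rs \<Longrightarrow> r < real (c * d)" and ab: "a * b > 1"
  shows "kemeny_nb (X \<union> Y) E
    = 1 / 2 + (real (card F) - real (card X) - real (card Y) + 1) * (2 * (a * b) / (a * b - 1))
      + (real (card X) - real (card Y)) * (2 * b / (b + 1))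
      + (\<Sum>r\<leftarrow>rs. 2 * (2 * (a * b) + a + b - r) / (real (c * d) - r))"
proof -
  let ?K = "real (c * d)"
  let ?e = "card F" and ?n = "card Y" and ?m = "card X"
  define A where "A = complex_of_real a"
  define B where "B = complex_of_real b"
  define k where "k = A * B"
  have AB: "A = complex_of_nat c - 1" "B = complex_of_nat d - 1"
    by (auto simp: A_def B_def a_def b_def)
  have pos: "a > 0" "b > 0" using c_ge d_ge by (auto simp: a_def b_def)
  have K: "?K = (a + 1) * (b + 1)" by (simp add: a_def b_def)
  have KC: "complex_of_nat (c * d) = (A + 1) * (B + 1)" by (simp add: AB)
  have A0: "A \<noteq> 0" and B0: "B \<noteq> 0" and k0: "k \<noteq> 0" using pos by (auto simp: A_def B_def k_def)
  define p where "p = char_poly (chain_mat (arcs (X \<union> Y) E) (nb_walk (X \<union> Y) E))"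
  obtain \<gamma> where \<gamma>: "\<gamma> \<noteq> 0"
    "\<And>z. \<gamma> * fdet F (\<lambda>i j. z * kdelta i j - H i j) * (A * (z - 1)) ^ (?m + ?n) * (- (z + A)) ^ ?n
     = (A * (z - 1)) ^ ?e * (- (z + A)) ^ ?m
       * fdet Y (\<lambda>i j. - A * ((z + A) * (z + B)) * kdelta i j - (- A * z) * W i j)"
    by (rule nb_det[folded AB]) blast
  define zp where "zp = [:0, 0, k:]"
  define f1 where "f1 = [:- A, 0, A * k:]"
  define f2 where "f2 = [:- A, 0, - k:]"
  define qr where "qr r = (zp + [:A:]) * (zp + [:B:]) - [:complex_of_real r:] * zp" for r
  define q where "q = (\<Prod>r\<leftarrow>rs. [:- A:] * qr r)"
  define q1 where "q1 = [:- A:] * ([:- k, 0, k:] * [:- 1, 0, k:])"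
  have id: "[:\<gamma> * k ^ ?e:] * ([:0, 1:] ^ ?e * (f1 ^ (?m + ?n) * (f2 ^ ?n * p)))
      = [:0, 1:] ^ ?e * (f1 ^ ?e * (f2 ^ ?m * (q1 * q)))"
  proof (intro poly_eq_poly_eq_iff[THEN iffD1] ext)
    fix x :: complex
    define z where "z = k * x\<^sup>2"
    have zp: "poly zp x = z" by (simp add: zp_def z_def power2_eq_square)
    have f1: "poly f1 x = A * (z - 1)" by (simp add: f1_def z_def power2_eq_square algebra_simps)
    have f2: "poly f2 x = - (z + A)" by (simp add: f2_def z_def power2_eq_square algebra_simps)
    have q: "poly q x = (\<Prod>r\<leftarrow>rs. - A * ((z + A) * (z + B)) - (- A * z) * complex_of_real r)"
      by (simp add: q_def qr_def poly_prod_list o_def zp algebra_simps)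
    have q1: "poly q1 x = - A * ((z + A) * (z + B)) - (- A * z) * of_nat (c * d)"
      unfolding KC by (simp add: q1_def z_def k_def power2_eq_square algebra_simps)
    have "k ^ ?e * fdet F (\<lambda>i j. x\<^sup>2 * kdelta i j - H i j / (A * B)) = fdet F (\<lambda>i j. z * kdelta i j - H i j)"
      unfolding fdet_smult[OF finite_F, symmetric]
      using k0 by (intro fdet_cong[OF finite_F]) (simp add: z_def k_def algebra_simps)
    then have h: "k ^ ?e * (x ^ ?e * poly p x) = x ^ ?e * fdet F (\<lambda>i j. z * kdelta i j - H i j)"
      unfolding p_def nb_chain_poly AB[symmetric] by (simp only: mult.left_commute[of "k ^ ?e"])
    have "(\<gamma> * k ^ ?e) * (x ^ ?e * ((A * (z - 1)) ^ (?m + ?n) * ((- (z + A)) ^ ?n * poly p x)))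
      = \<gamma> * (k ^ ?e * (x ^ ?e * poly p x)) * (A * (z - 1)) ^ (?m + ?n) * (- (z + A)) ^ ?n"
      by (simp only: mult_ac)
    also have "\<dots> = x ^ ?e * (\<gamma> * fdet F (\<lambda>i j. z * kdelta i j - H i j) * (A * (z - 1)) ^ (?m + ?n) * (- (z + A)) ^ ?n)"
      unfolding h by (simp only: mult_ac)
    also have "\<dots> = x ^ ?e * ((A * (z - 1)) ^ ?e * ((- (z + A)) ^ ?m * (poly q1 x * poly q x)))"
      unfolding \<gamma>(2) det q q1 by (simp only: mult_ac)
    finally show "poly ([:\<gamma> * k ^ ?e:] * ([:0, 1:] ^ ?e * (f1 ^ (?m + ?n) * (f2 ^ ?n * p)))) x
      = poly ([:0, 1:] ^ ?e * (f1 ^ ?e * (f2 ^ ?m * (q1 * q)))) x"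
      by (simp only: poly_mult poly_power f1 f2) simp
  qed
  have kr: "k = complex_of_real (a * b)" by (simp add: k_def A_def B_def)
  have k1: "k - 1 \<noteq> 0"
  proof
    assume "k - 1 = 0"
    then have "complex_of_real (a * b) = complex_of_real 1" by (simp add: kr)
    then have "a * b = 1" by (simp only: of_real_eq_iff)
    then show False using ab by simp
  qed
  have qr: "ksum (qr r) = complex_of_real (2 * (2 * (a * b) + a + b - r) / (?K - r))" "qr r \<noteq> 0"
    if "r \<in> set rs" for r
  proof -
    have "complex_of_real r \<noteq> complex_of_real ((a + 1) * (b + 1))"
      using lt[OF that] unfolding K of_real_eq_iff by simp
    then have ne: "complex_of_real r \<noteq> (A + 1) * (B + 1)" by (simp add: A_def B_def)
    show "qr r \<noteq> 0" unfolding qr_def zp_def by (rule ksum_biquadratic(2)[OF k_def k0 ne])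
    have "ksum (qr r) = 2 * (2 * k + A + B - complex_of_real r) / ((A + 1) * (B + 1) - complex_of_real r)"
      unfolding qr_def zp_def by (rule ksum_biquadratic(1)[OF k_def k0 ne])
    then show "ksum (qr r) = complex_of_real (2 * (2 * (a * b) + a + b - r) / (?K - r))"
      unfolding K kr A_def B_def by simp
  qed
  have q0: "0 \<notin> set (map (\<lambda>r. [:- A:] * qr r) rs)" using qr(2) A0 by auto
  have qn: "q \<noteq> 0" unfolding q_def using q0 by (simp only: prod_list_zero_iff not_False_eq_True)
  have mA: "ksum ([:- A:] * s) = ksum s" if "s \<noteq> 0" for s
    using that A0 by (subst ksum_mult) (auto simp: ksum_const)
  have kq: "ksum q = complex_of_real (\<Sum>r\<leftarrow>rs. 2 * (2 * (a * b) + a + b - r) / (?K - r))"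
    unfolding q_def ksum_prod_list[OF q0] sum_list_of_real[symmetric]
    by (intro arg_cong[where f = sum_list]) (simp add: mA qr del: mult_pCons_left)
  have n1: "f1 \<noteq> 0" "f2 \<noteq> 0" using A0 by (auto simp: f1_def f2_def)
  have nq1': "[:- k, 0, k:] * [:- 1, 0, k:] \<noteq> 0" using k0 by (intro no_zero_divisors) auto
  have nq1: "q1 \<noteq> 0" unfolding q1_def using A0 by (intro no_zero_divisors nq1') auto
  have pn: "p \<noteq> 0" using id qn n1 nq1 by auto
  have kf1: "ksum f1 = complex_of_real (2 * (a * b) / (a * b - 1))"
  proof -
    have eq: "A * k + - A = A * (k - 1)" by (simp add: algebra_simps)
    have "ksum f1 = 2 * (A * k) / (A * k + - A)"
      unfolding f1_def by (subst ksum_even_quadratic) (use A0 k0 k1 eq in auto)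
    also have "\<dots> = 2 * k / (k - 1)" unfolding eq using A0 by simp
    finally show ?thesis unfolding kr by simp
  qed
  have kf2: "ksum f2 = complex_of_real (2 * b / (b + 1))"
  proof -
    have eq: "- k + - A = - A * (B + 1)" by (simp add: k_def algebra_simps)
    have "B + 1 \<noteq> 0" using d_ge by (simp add: AB)
    then have "ksum f2 = 2 * (- k) / (- k + - A)"
      unfolding f2_def by (subst ksum_even_quadratic) (use A0 k0 eq in auto)
    also have "\<dots> = 2 * B / (B + 1)" unfolding eq using A0 by (simp add: k_def)
    finally show ?thesis unfolding B_def by simp
  qed
  have kq1: "ksum q1 = complex_of_real (1 / 2 + 2 * (a * b) / (a * b - 1))"
  proof -
    have "ksum q1 = ksum ([:- k, 0, k:] * [:- 1, 0, k:])" unfolding q1_def by (rule mA[OF nq1'])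
    also have "\<dots> = ksum [:- k, 0, k:] + ksum [:- 1, 0, k:]"
      using k0 by (intro ksum_mult) auto
    also have "\<dots> = 1 / 2 + 2 * k / (k - 1)"
      using k0 k1 by (simp add: ksum_even_quadratic)
    finally show ?thesis unfolding kr by simp
  qed
  have "ksum ([:\<gamma> * k ^ ?e:] * ([:0, 1:] ^ ?e * (f1 ^ (?m + ?n) * (f2 ^ ?n * p))))
      = of_nat ?e + (of_nat (?m + ?n) * ksum f1 + (of_nat ?n * ksum f2 + ksum p))"
  proof -
    have nz: "[:\<gamma> * k ^ ?e:] \<noteq> 0" "[:0, 1:] ^ ?e \<noteq> (0 :: complex poly)" "f1 ^ (?m + ?n) \<noteq> 0" "f2 ^ ?n \<noteq> 0"
      using \<gamma>(1) k0 n1 by auto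
    note n4 = no_zero_divisors[OF nz(4) pn]
    note n3 = no_zero_divisors[OF nz(3) n4]
    note n2 = no_zero_divisors[OF nz(2) n3]
    show ?thesis
      unfolding ksum_mult[OF nz(1) n2] ksum_mult[OF nz(2) n3] ksum_mult[OF nz(3) n4]
        ksum_mult[OF nz(4) pn] ksum_power[OF n1(1)] ksum_power[OF n1(2)]
      using \<gamma>(1) k0 by (simp add: ksum_power ksum_const)
  qed
  moreover have "ksum ([:0, 1:] ^ ?e * (f1 ^ ?e * (f2 ^ ?m * (q1 * q))))
      = of_nat ?e + (of_nat ?e * ksum f1 + (of_nat ?m * ksum f2 + (ksum q1 + ksum q)))"
  proof -
    have nz: "[:0, 1:] ^ ?e \<noteq> (0 :: complex poly)" "f1 ^ ?e \<noteq> 0" "f2 ^ ?m \<noteq> 0"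
      using n1 by auto
    note n4 = no_zero_divisors[OF nq1 qn]
    note n3 = no_zero_divisors[OF nz(3) n4]
    note n2 = no_zero_divisors[OF nz(2) n3]
    show ?thesis
      unfolding ksum_mult[OF nz(1) n2] ksum_mult[OF nz(2) n3] ksum_mult[OF nz(3) n4]
        ksum_mult[OF nq1 qn] ksum_power[OF n1(1)] ksum_power[OF n1(2)]
      by (simp add: ksum_power)
  qed
  ultimately have "ksum p = complex_of_real (1 / 2 + (real ?e - real ?m - real ?n + 1) * (2 * (a * b) / (a * b - 1))
      + (real ?m - real ?n) * (2 * b / (b + 1))
      + (\<Sum>r\<leftarrow>rs. 2 * (2 * (a * b) + a + b - r) / (?K - r)))"
  proof -
    assume l: "ksum ([:\<gamma> * k ^ ?e:] * ([:0, 1:] ^ ?e * (f1 ^ (?m + ?n) * (f2 ^ ?n * p))))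
        = of_nat ?e + (of_nat (?m + ?n) * ksum f1 + (of_nat ?n * ksum f2 + ksum p))"
      and r: "ksum ([:0, 1:] ^ ?e * (f1 ^ ?e * (f2 ^ ?m * (q1 * q))))
        = of_nat ?e + (of_nat ?e * ksum f1 + (of_nat ?m * ksum f2 + (ksum q1 + ksum q)))"
    define T1 where "T1 = 2 * (a * b) / (a * b - 1)"
    define T2 where "T2 = 2 * b / (b + 1)"
    define T3 where "T3 = (\<Sum>r\<leftarrow>rs. 2 * (2 * (a * b) + a + b - r) / (?K - r))"
    note k = kf1[folded T1_def] kf2[folded T2_def] kq1[folded T1_def] kq[folded T3_def]
    have "of_nat (?m + ?n) * complex_of_real T1 + (of_nat ?n * complex_of_real T2 + ksum p)
      = of_nat ?e * complex_of_real T1 + (of_nat ?m * complex_of_real T2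
        + (complex_of_real (1 / 2 + T1) + complex_of_real T3))"
      using l r unfolding id k by simp
    then show ?thesis unfolding T1_def[symmetric] T2_def[symmetric] T3_def[symmetric]
      by (simp add: algebra_simps)
  qed
  then show ?thesis unfolding kemeny_nb_def kemeny_ksum p_def[symmetric]
    by (simp only: Re_complex_of_real)
qed

end

section \<open>The inequalities\<close>

text \<open>Jensen's inequality for 1/t: the convex function lies above its tangent at the mean
  \<open>\<tau>\<close>, and the deviations from the mean sum to 0.\<close>

lemma sum_list_inverse_ge:
  fixes ts :: "real list"
  assumes "\<And>t. t \<in> set ts \<Longrightarrow> t > 0" and "ts \<noteq> []"
  shows "(\<Sum>t\<leftarrow>ts. 1 / t) \<ge> (real (length ts))\<^sup>2 / sum_list ts"
proof -
  define \<tau> where "\<tau> = sum_list ts / real (length ts)"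
  have "sum_list ts > 0"
  proof -
    obtain t ts' where ts: "ts = t # ts'" using assms(2) by (cases ts) auto
    have "sum_list ts' \<ge> 0" using assms(1) by (intro sum_list_nonneg) (auto simp: ts less_imp_le)
    then show ?thesis using assms(1)[of t] by (simp add: ts)
  qed
  then have \<tau>: "\<tau> > 0" using assms(2) by (simp add: \<tau>_def)
  have tangent: "2 / \<tau> - t / \<tau>\<^sup>2 \<le> 1 / t" if "t > 0" for t
  proof -
    have "0 \<le> (t - \<tau>)\<^sup>2 / (t * \<tau>\<^sup>2)" using that by simp
    also have "\<dots> = 1 / t - (2 / \<tau> - t / \<tau>\<^sup>2)"
      using that \<tau> by (simp add: field_simps power2_eq_square)
    finally show ?thesis by simp
  qed
  have "(\<Sum>t\<leftarrow>ts. 2 / \<tau> - t / \<tau>\<^sup>2) \<le> (\<Sum>t\<leftarrow>ts. 1 / t)"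
    using assms(1) by (intro sum_list_mono tangent)
  moreover have "(\<Sum>t\<leftarrow>ts. 2 / \<tau> - t / \<tau>\<^sup>2) = real (length ts) * (2 / \<tau>) - sum_list ts / \<tau>\<^sup>2" for \<tau> :: real
    by (induction ts) (auto simp: algebra_simps add_divide_distrib)
  moreover have "real (length ts) * (2 / \<tau>) - sum_list ts / \<tau>\<^sup>2 = (real (length ts))\<^sup>2 / sum_list ts"
    using assms(2) \<open>sum_list ts > 0\<close> by (simp add: \<tau>_def field_simps power2_eq_square)
  ultimately show ?thesis by simp
qed

text \<open>Here the exceptional graphs enter: the inequality fails when \<open>n = c\<close> and \<open>(c, d)\<close> is one of
  the excluded pairs.\<close>

lemma common_neighbour_bound_suffices:
  fixes c d n :: nat
  assumes c: "2 \<le> c" "c \<le> d" "c \<le> n" "3 \<le> d"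
    and ex: "n = c \<Longrightarrow> (c, d) \<notin> {(2, 3), (2, 4), (2, 5), (3, 3)}"
  shows "real n / real d + 1 / ((real c - 1) * (real d - 1) - 1)
      < (real c + real d) * ((real n - 1)\<^sup>2 / (real d * real n * (real c - 1)))"
proof -
  define a where "a = real c - 1"
  define D where "D = real d"
  define N where "N = real n"
  define q where "q = a * (D - 1) - 1"
  have a: "a \<ge> 1" and D: "D \<ge> 3" "D \<ge> a + 1" and N: "N \<ge> 2" "N \<ge> a + 1"
    using c by (auto simp: a_def D_def N_def)
  have "a * (D - 1) \<ge> 1 * 2" using a D by (intro mult_mono) auto
  then have q: "q \<ge> 1" by (simp add: q_def)
  \<comment> \<open>The claim multiplied by D N a.\<close>
  have main: "N\<^sup>2 * a + D * N * a / q < (a + 1 + D) * (N - 1)\<^sup>2"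
  proof (cases "n = 2")
    case True
    \<comment> \<open>Here the graph is K_{2,d} and the exclusions leave d >= 6. With q = D - 2 the
      claim becomes D (D - 6) + 4 > 0.\<close>
    then have "c = 2" using c by auto
    then have "d \<ge> 6" using ex True c by force
    then have D6: "D \<ge> 6" by (simp add: D_def)
    have vals: "a = 1" "N = 2" "q = D - 2" using \<open>c = 2\<close> True by (auto simp: a_def N_def q_def)
    have "D * (D - 6) \<ge> 0" using D6 by simp
    then have "4 * (D - 2) + D * 2 < (2 + D) * (D - 2)" by (simp add: algebra_simps)
    then show ?thesis unfolding vals using D6 by (simp add: field_simps power2_eq_square)
  next
    case False
    \<comment> \<open>This quantity is 3 q - D a; its sign bounds the second term of the claim by 3
      N.\<close>
    have "0 \<le> 2 * (a * (D - 3)) + 3 * (a - 1)"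
      using a D by (intro add_nonneg_nonneg mult_nonneg_nonneg) auto
    also have "\<dots> = 3 * q - D * a" by (simp add: q_def algebra_simps)
    finally have "D * a \<le> 3 * q" by simp
    then have "D * a / q \<le> 3" using q by (simp add: divide_le_eq)
    then have "N * (D * a / q) \<le> N * 3" using N by (intro mult_left_mono) auto
    then have le: "D * N * a / q \<le> 3 * N" by (simp add: mult_ac)
    have "N\<^sup>2 * a + 3 * N < (a + 1 + D) * (N - 1)\<^sup>2"
    proof (cases "n = 3")
      case True
      \<comment> \<open>For n = 3 the inequality reads 4 D > 5 a + 5. It fails only for c = d = 3,
        the excluded K_{3,3}.\<close>
      then have "c = 2 \<or> c = 3" using c by auto
      then have "4 * D > 5 * a + 5 \<and> a \<le> 2"
      proof
        assume "c = 2" then show ?thesis using D by (simp add: a_def)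
      next
        assume "c = 3"
        then have "d \<ge> 4" using ex True c by force
        then show ?thesis using \<open>c = 3\<close> by (simp add: a_def D_def)
      qed
      then show ?thesis using True by (simp add: N_def power2_eq_square)
    next
      case F: False
      then have N4: "N \<ge> 4" using c \<open>n \<noteq> 2\<close> by (simp add: N_def)
      \<comment> \<open>For N >= 4, (N - 1)^2 is at least 9 N^2 / 16 and 3 N at most 3 N^2 / 4, so
        it suffices that 9 (a + 1 + D) > 16 a + 12. This follows from D >= a + 1.\<close>
      then have "4 * (N - 1) \<ge> 3 * N" by simp
      then have "(4 * (N - 1))\<^sup>2 \<ge> (3 * N)\<^sup>2" using N4 by (intro power_mono) auto
      then have "16 * (N - 1)\<^sup>2 \<ge> 9 * N\<^sup>2" by (simp add: power2_eq_square algebra_simps)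
      then have 1: "(a + 1 + D) * (16 * (N - 1)\<^sup>2) \<ge> (a + 1 + D) * (9 * N\<^sup>2)"
        using a D by (intro mult_left_mono) auto
      have "N * N \<ge> 4 * N" using N4 by (intro mult_right_mono) auto
      then have 2: "12 * N\<^sup>2 \<ge> 48 * N" by (simp add: power2_eq_square)
      have "9 * (a + 1 + D) - 16 * a - 12 > 0" using a D by simp
      then have "(9 * (a + 1 + D) - 16 * a - 12) * N\<^sup>2 > 0" using N by (intro mult_pos_pos) auto
      then show ?thesis using 1 2 by (simp add: algebra_simps)
    qed
    then show ?thesis using le by simp
  qed
  have pos: "D * N * a > 0" using a D N by simp
  have "N / D + 1 / q = (N\<^sup>2 * a + D * N * a / q) / (D * N * a)"
    using a D N q by (simp add: field_simps power2_eq_square)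
  also have "\<dots> < (a + 1 + D) * (N - 1)\<^sup>2 / (D * N * a)"
    using main pos by (intro divide_strict_right_mono)
  finally show ?thesis by (simp add: a_def D_def N_def q_def)
qed

text \<open>Put q = a b - 1 and K = (a + 1) (b + 1). In the comparison of (q / K) \<open>Ke\<close>
  with \<open>Knb\<close> both \<open>S\<close> terms are 2 q S, and the remaining terms compare one
  by one. For the upper bound, \<open>Ke - Knb\<close> simplifies to twice the difference of the two
  sides of \<open>key\<close>.\<close>

lemma ratio_bounds:
  fixes a b m n S Ke Knb :: real
  assumes a: "a \<ge> 1" and ba: "a \<le> b" and ab: "a * b > 1" and n: "n \<ge> 1"
    and mn: "m * (a + 1) = n * (b + 1)"
    and Ke: "Ke = 2 * (n * (b + 1)) - 2 * n + 1 / 2 + 2 * ((a + 1) * (b + 1)) * S"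
    and Knb: "Knb = 1 / 2 + (n * (b + 1) - m - n + 1) * (2 * (a * b) / (a * b - 1))
      + (m - n) * (2 * b / (b + 1)) + 2 * (n - 1) + 2 * (a * b - 1) * S"
    and S: "S \<ge> 0" and key: "n / (b + 1) + 1 / (a * b - 1) < (a + b + 2) * S"
  shows "(a * b - 1) / ((a + 1) * (b + 1)) \<le> Knb / Ke" "Knb / Ke < 1"
proof -
  define q where "q = a * b - 1"
  have q: "q > 0" using ab by (simp add: q_def)
  have b: "b \<ge> 1" using a ba by simp
  define K where "K = (a + 1) * (b + 1)"
  have K: "K > 0" "q < K" using a b by (auto simp: K_def q_def algebra_simps intro!: add_pos_pos)
  have m: "m = n * (b + 1) / (a + 1)" using mn a by (simp add: field_simps)
  have Ke': "Ke = 2 * n * b + 1 / 2 + 2 * K * S" by (simp add: Ke K_def algebra_simps)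
  have "K * S \<ge> 0" using K S by simp
  moreover have "n * b \<ge> 0" using n b by simp
  ultimately have Kepos: "Ke > 0" unfolding Ke' by linarith
  have e1: "n * (b + 1) - m - n + 1 = n * q / (a + 1) + 1"
    using a by (simp add: m q_def field_simps)
  have t1: "(n * (b + 1) - m - n + 1) * (2 * (a * b) / (a * b - 1)) = 2 * n * a * b / (a + 1) + 2 + 2 / q"
  proof -
    have "2 * (a * b) / (a * b - 1) = 2 * (a * b) / q" by (simp add: q_def)
    moreover have "(n * q / (a + 1) + 1) * (2 * (a * b) / q) = 2 * n * a * b / (a + 1) + 2 * (a * b) / q"
      using q a by (simp add: field_simps)
    moreover have "2 * (a * b) / q = 2 + 2 / q" using q by (simp add: q_def field_simps)
    ultimately show ?thesis unfolding e1 by simp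
  qed
  have t2: "(m - n) * (2 * b / (b + 1)) = 2 * n * b * (b - a) / K"
    using a b by (simp add: m K_def field_simps)
  have Knb': "Knb = 1 / 2 + 2 * n * a * b / (a + 1) + 2 / q + 2 * n * b * (b - a) / K + 2 * n + 2 * q * S"
    unfolding Knb t1 t2 by (simp add: q_def)
  have "q / K * Ke \<le> Knb"
  proof -
    have qk: "q / K \<le> 1" "q / K \<ge> 0" using K q by auto
    have 1: "q / K * (2 * n * b) \<le> 2 * n * a * b / (a + 1)"
    proof -
      have "q * (a + 1) \<le> a * K"
      proof -
        have "a * K - q * (a + 1) = (a + 1) * (a + 1)" by (simp add: K_def q_def algebra_simps)
        then show ?thesis using a by (smt (verit) mult_nonneg_nonneg)
      qed
      then have "q / K \<le> a / (a + 1)" using K a by (simp add: field_simps)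
      then have "q / K * (2 * n * b) \<le> a / (a + 1) * (2 * n * b)"
        using n b by (intro mult_right_mono) auto
      then show ?thesis by (simp add: mult_ac)
    qed
    have 2: "q / K * (1 / 2) \<le> 1 / 2" using qk by simp
    have 3: "q / K * (2 * K * S) = 2 * q * S" using K by simp
    have 4: "0 \<le> 2 / q" "0 \<le> 2 * n * b * (b - a) / K" using q K n b ba by auto
    have "x + y + w \<le> 1 / 2 + A + u + v + 2 * n + w"
      if "x \<le> A" "y \<le> 1 / 2" "0 \<le> u" "0 \<le> v" for x y w A u v :: real
      using that n by linarith
    from this[OF 1 2 4] show ?thesis unfolding Ke' Knb' distrib_left 3 .
  qed
  then have "q / K \<le> Knb / Ke" using Kepos by (simp add: le_divide_eq)
  then show "(a * b - 1) / ((a + 1) * (b + 1)) \<le> Knb / Ke" by (simp add: q_def K_def)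
  have Kq: "K - q = a + b + 2" by (simp add: K_def q_def algebra_simps)
  \<comment> \<open>Over the common denominator K these terms nearly cancel.\<close>
  have "2 * n * b - 2 * n * a * b / (a + 1) - 2 * n * b * (b - a) / K - 2 * n = - 2 * (n / (b + 1))"
  proof -
    have "2 * n * a * b / (a + 1) = 2 * n * a * b * (b + 1) / K" "n / (b + 1) = n * (a + 1) / K"
      using a b by (simp_all add: K_def)
    moreover have "2 * n * b - x / K - y / K - 2 * n = ((2 * n * b - 2 * n) * K - x - y) / K" for x y
      using K by (simp add: field_simps)
    moreover have "(2 * n * b - 2 * n) * K - 2 * n * a * b * (b + 1) - 2 * n * b * (b - a)
        = - 2 * (n * (a + 1))"
      by (simp add: K_def algebra_simps)
    ultimately show ?thesis by (simp only:)
  qed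
  then have "Ke - Knb = 2 * ((K - q) * S - n / (b + 1) - 1 / q)"
    unfolding Ke' Knb' by (simp add: algebra_simps)
  then have "Ke - Knb = 2 * ((a + b + 2) * S - n / (b + 1) - 1 / (a * b - 1))"
    unfolding Kq by (simp only: q_def)
  then have "Ke - Knb > 0" using key by simp
  then show "Knb / Ke < 1" using Kepos by simp
qed

section \<open>The ratio for c <= d and the general case\<close>

context biregular_graph
begin

text \<open>Each vertex of \<open>X\<close> then sees all of \<open>Y\<close>, and counting edges
  gives \<open>card X = d\<close>. This identifies the boundary case n = c of the numerical estimate
  with the excluded graphs.\<close>

lemma complete_bipartite_if_card_Y:
  assumes "card Y = c"
  shows "is_complete_bipartite (X \<union> Y) E c d"
proof -
  have E: "E x y" if "x \<in> X" "y \<in> Y" for x y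
  proof -
    have "{y \<in> Y. E x y} = Y"
      using degree_X[OF that(1)] assms finite_Y by (intro card_subset_eq) auto
    then show ?thesis using that(2) by blast
  qed
  have "card X = d" using double_count assms c_ge by simp
  moreover have "E u v \<longleftrightarrow> u \<in> Y \<and> v \<in> X \<or> u \<in> X \<and> v \<in> Y" for u v
    using E E_sym E_bipartite by blast
  ultimately show ?thesis
    unfolding is_complete_bipartite_def using assms disjoint
    by (intro exI[of _ Y] exI[of _ X]) auto
qed

text \<open>The order c <= d serves the numerical estimate and the sign of \<open>b - a\<close> in
  \<open>ratio_bounds\<close>.\<close>

lemma kemeny_ratio:
  assumes cd: "c \<le> d" "(c, d) \<noteq> (2, 2)"
    and ex: "\<And>m n. (m, n) \<in> {(2, 3), (2, 4), (2, 5), (3, 3)} \<Longrightarrow> \<not> is_complete_bipartite (X \<union> Y) E m n"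
  shows "1 - real (c + d) / real (c * d) \<le> kemeny_nb (X \<union> Y) E / kemeny_edge (X \<union> Y) E
    \<and> kemeny_nb (X \<union> Y) E / kemeny_edge (X \<union> Y) E < 1"
proof -
  obtain rs where len: "length rs = card Y - 1" and lt: "\<And>r. r \<in> set rs \<Longrightarrow> r < real (c * d)"
    and sum: "sum_list rs = real (card Y * d) - real (c * d)"
    and det: "\<And>u v. fdet Y (\<lambda>i j. u * kdelta i j - v * W i j)
        = (u - v * of_nat (c * d)) * (\<Prod>r\<leftarrow>rs. u - v * complex_of_real r)"
    by (rule W_spectrum) blast
  define a where "a = real c - 1"
  define b where "b = real d - 1"
  define n where "n = real (card Y)"
  define K where "K = real (c * d)"
  define S where "S = (\<Sum>r\<leftarrow>rs. 1 / (K - r))"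
  have d3: "d \<ge> 3" using cd c_ge by (cases "d = 2") auto
  have K: "K = (a + 1) * (b + 1)" by (simp add: K_def a_def b_def)
  have a: "a \<ge> 1" "a \<le> b" "b \<ge> 2" using c_ge cd d3 by (auto simp: a_def b_def)
  have "a * b \<ge> 1 * 2" using a by (intro mult_mono) auto
  then have ab: "a * b > 1" by simp
  have n: "n \<ge> 2" "card Y \<ge> 2" using c_le_card_Y c_ge by (auto simp: n_def)
  have lenr: "real (length rs) = n - 1" using len n by (simp add: n_def)
  have ltK: "K - r > 0" if "r \<in> set rs" for r using lt[OF that] by (simp add: K_def)
  have sums: "(\<Sum>r\<leftarrow>rs. 2 * K / (K - r)) = 2 * K * S"
    "(\<Sum>r\<leftarrow>rs. 2 * (2 * (a * b) + a + b - r) / (K - r)) = 2 * (n - 1) + 2 * (a * b - 1) * S"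
  proof -
    show "(\<Sum>r\<leftarrow>rs. 2 * K / (K - r)) = 2 * K * S"
      unfolding S_def by (simp add: sum_list_const_mult[symmetric])
    \<comment> \<open>As K = a b + a + b + 1, the numerator is 2 (K - r) + 2 (a b - 1): each
      eigenvalue contributes a constant 2 and a multiple of its term in \<open>S\<close>.\<close>
    have "2 * (2 * (a * b) + a + b - r) / (K - r) = 2 + 2 * (a * b - 1) * (1 / (K - r))"
      if "r \<in> set rs" for r
    proof -
      have "2 * (2 * (a * b) + a + b - r) = 2 * (K - r) + 2 * (a * b - 1)"
        by (simp add: K algebra_simps)
      moreover have "(2 * t + w) / t = 2 + w * (1 / t)" if "t > 0" for t w :: real
        using that by (simp add: field_simps)
      ultimately show ?thesis using ltK[OF that] by metis
    qed
    then have "(\<Sum>r\<leftarrow>rs. 2 * (2 * (a * b) + a + b - r) / (K - r))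
        = (\<Sum>r\<leftarrow>rs. 2 + 2 * (a * b - 1) * (1 / (K - r)))"
      by (intro arg_cong[where f = sum_list] map_cong refl)
    also have "\<dots> = real (length rs) * 2 + 2 * (a * b - 1) * S"
      unfolding S_def by (simp only: sum_list_addf sum_list_const_mult sum_list_triv)
    finally show "(\<Sum>r\<leftarrow>rs. 2 * (2 * (a * b) + a + b - r) / (K - r)) = 2 * (n - 1) + 2 * (a * b - 1) * S"
      unfolding lenr by simp
  qed
  have cF: "real (card F) = n * (b + 1)" by (simp add: card_F n_def b_def)
  have Ke: "kemeny_edge (X \<union> Y) E = 2 * (n * (b + 1)) - 2 * n + 1 / 2 + 2 * ((a + 1) * (b + 1)) * S"
    using kemeny_edge_formula[OF det lt] unfolding K_def[symmetric] sums cF n_def[symmetric] K[symmetric] by simp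
  have Knb: "kemeny_nb (X \<union> Y) E = 1 / 2 + (n * (b + 1) - real (card X) - n + 1) * (2 * (a * b) / (a * b - 1))
      + (real (card X) - n) * (2 * b / (b + 1)) + 2 * (n - 1) + 2 * (a * b - 1) * S"
    using kemeny_nb_formula[OF det lt, folded a_def b_def, OF _ ab]
    unfolding K_def[symmetric] sums cF n_def[symmetric] by simp
  have S0: "S \<ge> 0" unfolding S_def using ltK by (intro sum_list_nonneg) (auto intro: less_imp_le)
  have "S \<ge> (n - 1)\<^sup>2 / ((b + 1) * n * a)"
  proof -
    let ?ts = "map (\<lambda>r. K - r) rs"
    \<comment> \<open>The trace of \<open>W\<close> fixes the total gap: (n - 1) K - (n d - K) = n d
      (c - 1).\<close>
    have "sum_list ?ts = real (length rs) * K - sum_list rs"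
      by (induction rs) (auto simp: algebra_simps)
    also have "\<dots> = (n - 1) * ((a + 1) * (b + 1)) - (n * (b + 1) - (a + 1) * (b + 1))"
      unfolding lenr sum K_def[symmetric] K by (simp add: n_def b_def)
    also have "\<dots> = (b + 1) * n * a" by (simp add: algebra_simps)
    finally have "sum_list ?ts = (b + 1) * n * a" .
    moreover have "(real (length ?ts))\<^sup>2 / sum_list ?ts \<le> (\<Sum>t\<leftarrow>?ts. 1 / t)"
      using ltK len n by (intro sum_list_inverse_ge) auto
    ultimately show ?thesis unfolding S_def by (simp add: lenr o_def)
  qed
  moreover have "n / (b + 1) + 1 / (a * b - 1) < (a + b + 2) * ((n - 1)\<^sup>2 / ((b + 1) * n * a))"
  proof -
    have "(c, d) \<notin> {(2, 3), (2, 4), (2, 5), (3, 3)}" if "card Y = c"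
      using complete_bipartite_if_card_Y[OF that] ex by blast
    from common_neighbour_bound_suffices[OF c_ge cd(1) c_le_card_Y d3 this]
    have "real (card Y) / real d + 1 / ((real c - 1) * (real d - 1) - 1)
      < (real c + real d) * ((real (card Y) - 1)\<^sup>2 / (real d * real (card Y) * (real c - 1)))" .
    moreover have "real c + real d = a + b + 2" "real d = b + 1" by (simp_all add: a_def b_def)
    ultimately show ?thesis by (simp add: a_def[symmetric] b_def[symmetric] n_def[symmetric] add_ac)
  qed
  moreover have "(a + b + 2) * ((n - 1)\<^sup>2 / ((b + 1) * n * a)) \<le> (a + b + 2) * S"
    using calculation(1) a by (intro mult_left_mono) auto
  ultimately have key: "n / (b + 1) + 1 / (a * b - 1) < (a + b + 2) * S" by linarith
  have mn: "real (card X) * (a + 1) = n * (b + 1)"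
    using double_count unfolding a_def b_def n_def by (simp flip: of_nat_mult)
  have "(a * b - 1) / ((a + 1) * (b + 1)) = 1 - real (c + d) / real (c * d)"
  proof -
    have "a * b - 1 = K - real (c + d)" by (simp add: a_def b_def K_def algebra_simps)
    moreover have "K > 0" using c_ge d_ge by (simp add: K_def)
    ultimately show ?thesis
      unfolding K[symmetric] K_def[symmetric] by (simp only: diff_divide_distrib) simp
  qed
  then show ?thesis
    using ratio_bounds[OF a(1,2) ab _ mn Ke Knb S0 key] n by simp
qed

end

theorem theorem4p5:
  fixes V :: "'a set" and E :: "'a \<Rightarrow> 'a \<Rightarrow> bool" and c d :: nat
  assumes "simple_graph V E" and "connected_graph V E" and "biregular V E c d"
    and "c \<ge> 2" and "d \<ge> 2" and "(c, d) \<noteq> (2, 2)"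
    and "\<not> is_complete_bipartite V E 2 3" and "\<not> is_complete_bipartite V E 2 4"
    and "\<not> is_complete_bipartite V E 2 5" and "\<not> is_complete_bipartite V E 3 3"
  shows "1 - real (c + d) / real (c * d) \<le> kemeny_nb V E / kemeny_edge V E
    \<and> kemeny_nb V E / kemeny_edge V E < 1"
proof -
  obtain X Y where XY: "X \<inter> Y = {}" "X \<union> Y = V"
    and bip: "\<And>u v. E u v \<Longrightarrow> u \<in> X \<and> v \<in> Y \<or> u \<in> Y \<and> v \<in> X"
    and deg: "\<And>x. x \<in> X \<Longrightarrow> Defs.degree V E x = c" "\<And>y. y \<in> Y \<Longrightarrow> Defs.degree V E y = d"
    using assms(3) unfolding biregular_def by blast
  have sym: "E v u" if "E u v" for u v using assms(1) that unfolding simple_graph_def by blast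
  have fin: "finite X" "finite Y" using assms(1) XY unfolding simple_graph_def by auto
  have nX: "neighbors V E x = {y \<in> Y. E x y}" "{y \<in> Y. E x y} = {y \<in> Y. E y x}" if "x \<in> X" for x
    using bip[of x] that XY sym by (auto simp: neighbors_def)
  have nY: "neighbors V E y = {x \<in> X. E y x}" "{x \<in> X. E y x} = {x \<in> X. E x y}" if "y \<in> Y" for y
    using bip[of y] that XY sym by (auto simp: neighbors_def)
  have X: "card {y \<in> Y. E x y} = c" "card {y \<in> Y. E y x} = c" if "x \<in> X" for x
    using deg(1)[OF that] nX[OF that] by (auto simp: Defs.degree_def)
  have Y: "card {x \<in> X. E x y} = d" "card {x \<in> X. E y x} = d" if "y \<in> Y" for y
    using deg(2)[OF that] nY[OF that] by (auto simp: Defs.degree_def)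
  have conn: "E\<^sup>*\<^sup>* u v" if "u \<in> V" "v \<in> V" for u v
    using assms(2) that unfolding connected_graph_def by blast
  have ne: "V \<noteq> {}" using assms(2) unfolding connected_graph_def by blast
  have ex: "\<not> is_complete_bipartite V E m n" if "(m, n) \<in> {(2, 3), (2, 4), (2, 5), (3, 3)}" for m n
    using that assms(7-10) by auto
  \<comment> \<open>If c > d, exchanging \<open>X\<close> with \<open>Y\<close> and c with d leaves
    the vertex set, the edges and both walks unchanged.\<close>
  show ?thesis
  proof (cases "c \<le> d")
    case True
    interpret biregular_graph X Y E c d
      by unfold_locales (use XY bip sym fin X Y conn ne assms in auto)
    show ?thesis using kemeny_ratio[OF True assms(6)] ex unfolding XY(2) by blast
  next
    case False
    interpret biregular_graph Y X E d c
      by unfold_locales (use XY bip sym fin X Y conn ne assms in auto)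
    have "Y \<union> X = V" using XY by auto
    with kemeny_ratio False ex have "1 - real (d + c) / real (d * c) \<le> kemeny_nb V E / kemeny_edge V E
      \<and> kemeny_nb V E / kemeny_edge V E < 1" by auto
    then show ?thesis by (simp add: add.commute mult.commute)
  qed
qed

end
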